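(* Let $\kappa\in\mathbb R$. For any geodesic triangle $T$ in $M_\kappa^2$, with iterated medial triangle subdivision $T_0=T,T_1,T_2,\ldots$, there exists $\delta>0$ such that, for all $n\in\mathbb N$, all the angles of (the triangles of) $T_n$ lie in the interval $(\delta,\pi-\delta)$.
   Context: $M_\kappa^2$ denotes the model surface of constant curvature $\kappa$ (a rescaled hyperbolic plane if $\kappa<0$, the Euclidean plane if $\kappa=0$, the round sphere of radius $1/\sqrt{\kappa}$ if $\kappa>0$). All geodesics are taken to be minimal. A geodesic triangle in $M_\kappa^2$ is a triple of points of $M_\kappa^2$ together with a choice of three geodesic segments joining each pair of points; if $\kappa>0$, the three vertices are moreover required to lie in the same open hemisphere. The iterated medial triangle subdivision of $T$ is the sequence of refining triangulations $T_0,T_1,T_2,\ldots$ defined inductively by: $T_0=T$; $T_{n+1}$ is obtained from $T_n$ by adding the midpoints of the edges of $T_n$ and, within each triangle of $T_n$, pairwise connecting its three midpoints by geodesic segments (this creates 4 new sub-triangles for each triangle of $T_n$).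
   Formalization: The triangle T is assumed nondegenerate (no geodesic segment contains all three vertices); for degenerate triangles, which the definition literally admits, angles are 0, π or undefined and the claim fails. *)

theory Defs
  imports "HOL-Analysis.Analysis"
begin

text \<open>
  All model surfaces live in \<open>\<real>\<^sup>3\<close>: for \<open>\<kappa> < 0\<close> the upper sheet of the hyperboloid
  \<open>\<langle>x|x\<rangle> = 1/\<kappa>\<close> of Minkowski space (the hyperbolic plane rescaled by \<open>1/sqrt (-\<kappa>)\<close>), for
  \<open>\<kappa> = 0\<close> the coordinate plane \<open>x\<^sub>3 = 0\<close>, and for \<open>\<kappa> > 0\<close> the round sphere of radius
  \<open>1/sqrt \<kappa>\<close>. The form below restricts to the Riemannian metric on the tangent planes.
\<close>

definition model_form :: "real \<Rightarrow> real^3 \<Rightarrow> real^3 \<Rightarrow> real" where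
  "model_form \<kappa> x y =
     (if \<kappa> < 0 then x$1 * y$1 + x$2 * y$2 - x$3 * y$3 else x \<bullet> y)"

definition model_surface :: "real \<Rightarrow> (real^3) set" where
  "model_surface \<kappa> =
     (if \<kappa> < 0 then {x. model_form \<kappa> x x = 1 / \<kappa> \<and> x$3 > 0}
      else if \<kappa> = 0 then {x. x$3 = 0}
      else sphere 0 (1 / sqrt \<kappa>))"

definition model_dist :: "real \<Rightarrow> real^3 \<Rightarrow> real^3 \<Rightarrow> real" where
  "model_dist \<kappa> x y =
     (if \<kappa> < 0 then arcosh (\<kappa> * model_form \<kappa> x y) / sqrt (- \<kappa>)
      else if \<kappa> = 0 then dist x y
      else arccos (\<kappa> * model_form \<kappa> x y) / sqrt \<kappa>)"

text \<open>Geodesics are minimal, i.e. isometric embeddings of intervals.\<close>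

definition geodesic_path :: "real \<Rightarrow> real^3 \<Rightarrow> real^3 \<Rightarrow> (real \<Rightarrow> real^3) \<Rightarrow> bool" where
  "geodesic_path \<kappa> p q c \<longleftrightarrow>
     c ` {0..model_dist \<kappa> p q} \<subseteq> model_surface \<kappa> \<and>
     c 0 = p \<and> c (model_dist \<kappa> p q) = q \<and>
     (\<forall>s\<in>{0..model_dist \<kappa> p q}. \<forall>t\<in>{0..model_dist \<kappa> p q}.
        model_dist \<kappa> (c s) (c t) = \<bar>s - t\<bar>)"

definition geodesic_segment :: "real \<Rightarrow> real^3 \<Rightarrow> real^3 \<Rightarrow> (real^3) set \<Rightarrow> bool" where
  "geodesic_segment \<kappa> p q S \<longleftrightarrow>
     p \<in> model_surface \<kappa> \<and> q \<in> model_surface \<kappa> \<and>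
     (\<exists>c. geodesic_path \<kappa> p q c \<and> S = c ` {0..model_dist \<kappa> p q})"

text \<open>
  For a geodesic segment \<open>S\<close> issuing from \<open>p\<close>, the point of \<open>S\<close> at distance \<open>t\<close> from \<open>p\<close> is
  the arc-length parametrization of \<open>S\<close>. Hence initial velocities are unit vectors with
  respect to \<^const>\<open>model_form\<close>, and no normalization is needed in the definition of angles.
\<close>

definition arclength_param :: "real \<Rightarrow> real^3 \<Rightarrow> (real^3) set \<Rightarrow> real \<Rightarrow> real^3" where
  "arclength_param \<kappa> p S t = (THE x. x \<in> S \<and> model_dist \<kappa> p x = t)"

definition initial_velocity :: "real \<Rightarrow> real^3 \<Rightarrow> (real^3) set \<Rightarrow> real^3" where
  "initial_velocity \<kappa> p S = vector_derivative (arclength_param \<kappa> p S) (at_right 0)"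

definition geodesic_angle :: "real \<Rightarrow> real^3 \<Rightarrow> (real^3) set \<Rightarrow> (real^3) set \<Rightarrow> real" where
  "geodesic_angle \<kappa> p S S' =
     arccos (model_form \<kappa> (initial_velocity \<kappa> p S) (initial_velocity \<kappa> p S'))"

text \<open>
  In \<open>Tri A B C a b c\<close> the points \<open>A\<close>, \<open>B\<close>, \<open>C\<close> are the vertices and \<open>a\<close>, \<open>b\<close>, \<open>c\<close> are the
  chosen edges, each opposite to the vertex of the same letter.
\<close>

datatype tri = Tri "real^3" "real^3" "real^3" "(real^3) set" "(real^3) set" "(real^3) set"

fun vertices :: "tri \<Rightarrow> (real^3) set" where
  "vertices (Tri A B C a b c) = {A, B, C}"

fun geodesic_triangle :: "real \<Rightarrow> tri \<Rightarrow> bool" where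
  "geodesic_triangle \<kappa> (Tri A B C a b c) \<longleftrightarrow>
     geodesic_segment \<kappa> B C a \<and> geodesic_segment \<kappa> C A b \<and> geodesic_segment \<kappa> A B c \<and>
     (\<kappa> > 0 \<longrightarrow> (\<exists>u. u \<bullet> A > 0 \<and> u \<bullet> B > 0 \<and> u \<bullet> C > 0))"

definition nondegenerate :: "real \<Rightarrow> tri \<Rightarrow> bool" where
  "nondegenerate \<kappa> T \<longleftrightarrow> \<not> (\<exists>p q S. geodesic_segment \<kappa> p q S \<and> vertices T \<subseteq> S)"

fun angles :: "real \<Rightarrow> tri \<Rightarrow> real set" where
  "angles \<kappa> (Tri A B C a b c) =
     {geodesic_angle \<kappa> A b c, geodesic_angle \<kappa> B c a, geodesic_angle \<kappa> C a b}"

definition segment_midpoint :: "real \<Rightarrow> real^3 \<Rightarrow> real^3 \<Rightarrow> (real^3) set \<Rightarrow> real^3" where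
  "segment_midpoint \<kappa> p q S = (THE m. m \<in> S \<and> model_dist \<kappa> p m = model_dist \<kappa> m q)"

definition subsegment :: "real \<Rightarrow> real^3 \<Rightarrow> real^3 \<Rightarrow> (real^3) set \<Rightarrow> (real^3) set" where
  "subsegment \<kappa> p m S = {x \<in> S. model_dist \<kappa> p x \<le> model_dist \<kappa> p m}"

text \<open>
  \<open>A'\<close>, \<open>B'\<close>, \<open>C'\<close> are the midpoints of \<open>a\<close>, \<open>b\<close>, \<open>c\<close>. The segments joining them are unique
  in the situations considered (always for \<open>\<kappa> \<le> 0\<close>; for points of an open hemisphere if
  \<open>\<kappa> > 0\<close>), so collecting the triangles for all possible segments \<open>a'\<close>, \<open>b'\<close>, \<open>c'\<close> yields
  just the four subtriangles.
\<close>

fun medial_subtriangles :: "real \<Rightarrow> tri \<Rightarrow> tri set" where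
  "medial_subtriangles \<kappa> (Tri A B C a b c) =
     (let A' = segment_midpoint \<kappa> B C a;
          B' = segment_midpoint \<kappa> C A b;
          C' = segment_midpoint \<kappa> A B c
      in {t. \<exists>a' b' c'. geodesic_segment \<kappa> B' C' a' \<and> geodesic_segment \<kappa> C' A' b' \<and>
               geodesic_segment \<kappa> A' B' c' \<and>
               t \<in> {Tri A C' B' a' (subsegment \<kappa> A B' b) (subsegment \<kappa> A C' c),
                    Tri C' B A' (subsegment \<kappa> B A' a) b' (subsegment \<kappa> B C' c),
                    Tri B' A' C (subsegment \<kappa> C A' a) (subsegment \<kappa> C B' b) c',
                    Tri A' B' C' a' b' c'}})"

primrec iterated_medial :: "real \<Rightarrow> tri \<Rightarrow> nat \<Rightarrow> tri set" where
  "iterated_medial \<kappa> T 0 = {T}"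
| "iterated_medial \<kappa> T (Suc n) = (\<Union>t\<in>iterated_medial \<kappa> T n. medial_subtriangles \<kappa> t)"

end

theory Submission
  imports Defs
begin

text \<open>
  Central projection straightens the problem. Place \<open>M\<^sub>\<kappa>\<close> in \<open>\<real>\<^sup>3\<close> as a sphere or a hyperboloid about the
  origin (for \<open>\<kappa> = 0\<close>, as the plane at height 1) and project it from the origin to an affine plane
  \<open>u \<bullet> x = 1\<close>: the gnomonic or Beltrami--Klein chart. Geodesics become straight segments, and the midpoint
  of \<open>p\<close> and \<open>q\<close>, being a positive multiple of \<open>p + q\<close>, becomes the weighted mean of the two chart
  points with weights \<open>u \<bullet> p\<close> and \<open>u \<bullet> q\<close>. All vertices of all subdivisions stay in the convex hull \<open>K\<close>
  of the three original chart points. On this compact set the weight of a point is bounded above and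
  away from 0 and is a Lipschitz function of its chart point. Hence the chart midpoint divides a side
  of a triangle with longest side \<open>D\<close> in a ratio \<open>\<tau> : 1 - \<tau>\<close> with \<open>\<bar>\<tau> - 1/2\<bar> \<le> e\<close>, where \<open>e\<close> is at most
  a constant times \<open>D\<close> and also stays below a constant smaller than 1/2.

  Up to factors \<open>1 + O(D)\<close> the medial step therefore halves the longest side and quarters the
  determinant \<open>\<Delta>\<close> of the three chart points: the quotient \<open>\<bar>\<Delta>\<bar> / D\<^sup>2\<close>, which measures how far the triangle is from
  being degenerate, loses at most a factor \<open>1 - O(D)\<close>. Since \<open>D\<close> shrinks geometrically, the product of
  these factors converges. This is expressed by a single potential: for a suitable constant \<open>M\<close> the quantity
  \<open>\<bar>\<Delta>\<bar> exp (- M D) / D\<^sup>2\<close> never decreases from a triangle to one of its four children (lemmas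
  \<open>fat_shrink\<close>, \<open>fat_corner\<close>, \<open>fat_inner_triangle\<close>, and \<open>fat_triangle_medial\<close> on the surface). It starts out
  positive, because a vanishing determinant would make the chart points collinear and put all three
  vertices on one edge (\<open>chart_det3_nonzero\<close>).

  To return to angles, write the cosine \<open>g\<close> of the angle at \<open>p\<close> as the product of two unit tangent vectors. A Gram
  determinant gives \<open>1 - g\<^sup>2\<close> as a constant times the square of \<open>det (p, q, r) / (sn L sn L')\<close>, where
  \<open>L\<close>, \<open>L'\<close> are the lengths of the adjacent sides (\<open>sine_squared_eq_det3\<close>). As \<open>sn L\<close> and \<open>sn L'\<close> are at
  most a constant times \<open>D\<close> (\<open>sn_dist_le_chart_dist\<close>), a lower bound on \<open>\<bar>\<Delta>\<bar> / D\<^sup>2\<close> bounds the sine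
  of every angle away from 0.
\<close>

section \<open>Fat triangles in an affine chart\<close>

definition det3 :: "real^3 \<Rightarrow> real^3 \<Rightarrow> real^3 \<Rightarrow> real" where
  "det3 x y z = x \<bullet> cross3 y z"

lemma inner_real3: "(x::real^3) \<bullet> y = x$1 * y$1 + x$2 * y$2 + x$3 * y$3"
  by (simp add: inner_vec_def sum_3)

lemma det3_expand:
  "det3 x y z = x$1 * (y$2 * z$3 - y$3 * z$2) + x$2 * (y$3 * z$1 - y$1 * z$3)
     + x$3 * (y$1 * z$2 - y$2 * z$1)"
  by (simp add: det3_def cross3_def inner_real3)

lemma det3_scaleR: "det3 (r *\<^sub>R x) (s *\<^sub>R y) (t *\<^sub>R z) = r * s * t * det3 x y z"
  by (simp add: det3_expand algebra_simps)

lemma det3_rotate: "det3 y z x = det3 x y z"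
  by (simp add: det3_expand algebra_simps)

lemma det3_add_multiples: "det3 x (y + s *\<^sub>R x) (z + t *\<^sub>R x) = det3 x y z"
  by (simp add: det3_expand algebra_simps)

lemma det3_corner:
  "det3 a ((1 - s) *\<^sub>R a + s *\<^sub>R b) ((1 - t) *\<^sub>R a + t *\<^sub>R c) = s * t * det3 a b c"
  by (simp add: det3_expand algebra_simps)

lemma det3_inner_triangle:
  "det3 ((1 - p) *\<^sub>R b + p *\<^sub>R c) ((1 - q) *\<^sub>R c + q *\<^sub>R a) ((1 - r) *\<^sub>R a + r *\<^sub>R b)
     = (p * q * r + (1 - p) * (1 - q) * (1 - r)) * det3 a b c"
  by (simp add: det3_expand algebra_simps)

definition longest_side :: "real^3 \<Rightarrow> real^3 \<Rightarrow> real^3 \<Rightarrow> real" where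
  "longest_side a b c = max (dist b c) (max (dist c a) (dist a b))"

lemma longest_side_rotate: "longest_side b c a = longest_side a b c"
  by (simp add: longest_side_def max.commute max.left_commute)

lemma side_le_longest_side:
  "dist b c \<le> longest_side a b c" "dist c a \<le> longest_side a b c" "dist a b \<le> longest_side a b c"
  by (auto simp: longest_side_def)

lemma longest_side_nonneg: "0 \<le> longest_side a b c"
  using side_le_longest_side(1)[of b c a] zero_le_dist[of b c] by linarith

text \<open>
  The exponential factor pays in advance for the distortion of all later subdivision steps. That the
  determinant is nonzero is a separate requirement because the inequality alone also holds for three
  coinciding points.
\<close>

definition fat :: "real \<Rightarrow> real \<Rightarrow> real^3 \<Rightarrow> real^3 \<Rightarrow> real^3 \<Rightarrow> bool" where
  "fat c\<^sub>0 M a b c \<longleftrightarrow> det3 a b c \<noteq> 0 \<and>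
     c\<^sub>0 * (longest_side a b c)\<^sup>2 * exp (M * longest_side a b c) \<le> \<bar>det3 a b c\<bar>"

lemma fat_rotate: "fat c\<^sub>0 M b c a \<longleftrightarrow> fat c\<^sub>0 M a b c"
  by (simp add: fat_def det3_rotate longest_side_rotate)

text \<open>
  Here \<open>e\<close> bounds the deviation of the division ratios from 1/2. Replacing \<open>D\<close> by \<open>(1/2 + e) D\<close> releases a
  factor \<open>exp (M (1/2 - e) D)\<close>, which has to absorb the loss
  \<open>(1/2 + e)\<^sup>2 / ((1/2 - e)\<^sup>2 (1 - 2e)) \<le> (1 - 2e)\<^sup>-\<^sup>5\<close> in the quotient of determinant and squared side.
  As \<open>1 - 2e \<ge> 2h\<close>, the loss is at most \<open>exp (5 e / h) \<le> exp (5 k D / h)\<close> and the released factor is at least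
  \<open>exp (M h D)\<close>, which explains the value of \<open>M\<close>.
\<close>

lemma fat_shrink:
  assumes "fat c\<^sub>0 M a b c" "0 \<le> c\<^sub>0" "0 < h" "0 \<le> k" and M: "M = 5 * k / h\<^sup>2"
    and e: "0 \<le> e" "e \<le> k * longest_side a b c" "e \<le> 1/2 - h"
    and D': "longest_side a' b' c' \<le> (1/2 + e) * longest_side a b c"
    and det': "(1/2 - e)\<^sup>2 * (1 - 2 * e) * \<bar>det3 a b c\<bar> \<le> \<bar>det3 a' b' c'\<bar>"
  shows "fat c\<^sub>0 M a' b' c'"
proof -
  define D where "D = longest_side a b c"
  define D1 where "D1 = longest_side a' b' c'"
  define y where "y = 1 - 2 * e"
  have D0: "0 \<le> D" "0 \<le> D1" by (auto simp: D_def D1_def longest_side_nonneg)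
  have y: "2 * h \<le> y" "0 < y" "y \<le> 1" using e assms(3) by (auto simp: y_def)
  have M0: "0 \<le> M" using assms by simp
  \<comment> \<open>The loss \<open>1 / y\<close> is at most \<open>exp (k D / h)\<close>; the choice of \<open>M\<close> pays for five of them.\<close>
  have "1 / y = 1 + (1 - y) / y" using y by (simp add: field_simps)
  also have "\<dots> \<le> exp ((1 - y) / y)" by (rule exp_ge_add_one_self)
  also have "(1 - y) / y \<le> (1 - y) / (2 * h)"
    using y assms(3) by (intro divide_left_mono) auto
  hence "exp ((1 - y) / y) \<le> exp ((1 - y) / (2 * h))" by simp
  also have "(1 - y) / (2 * h) = e / h" by (simp add: y_def)
  also have "e / h \<le> k * D / h" using e assms(3) by (auto simp: D_def divide_right_mono)
  hence "exp (e / h) \<le> exp (k * D / h)" by simp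
  finally have y1: "1 / y \<le> exp (k * D / h)" .
  have "(1 / y) ^ 5 \<le> exp (k * D / h) ^ 5"
    using y y1 by (intro power_mono) auto
  also have "\<dots> = exp (5 * (k * D / h))" by (simp add: exp_of_nat_mult[symmetric])
  also have "5 * (k * D / h) = M * h * D" using assms(3) by (simp add: M power2_eq_square)
  also have "M * h * D \<le> M * (1/2 - e) * D"
    using M0 D0 e by (intro mult_right_mono mult_left_mono) auto
  hence "exp (M * h * D) \<le> exp (M * (1/2 - e) * D)" by simp
  finally have "1 \<le> exp (M * (1/2 - e) * D) * y ^ 5"
    using y by (simp add: field_simps)
  hence "(1/2 + e)\<^sup>2 * (exp (M * (1/2 + e) * D) * 1)
      \<le> (1/2 + e)\<^sup>2 * (exp (M * (1/2 + e) * D) * (exp (M * (1/2 - e) * D) * y ^ 5))"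
    by (intro mult_left_mono) auto
  also have "\<dots> = (1/2 + e)\<^sup>2 * y ^ 5 * (exp (M * (1/2 + e) * D) * exp (M * (1/2 - e) * D))"
    by simp
  also have "exp (M * (1/2 + e) * D) * exp (M * (1/2 - e) * D) = exp (M * D)"
    by (simp add: exp_add[symmetric] algebra_simps)
  also have "(1/2 + e)\<^sup>2 * y ^ 5 \<le> (1/2 - e)\<^sup>2 * (1 - 2 * e)"
  proof -
    have "(1 + 2 * e) * y \<le> 1" by (simp add: y_def algebra_simps)
    hence "((1 + 2 * e) * y)\<^sup>2 \<le> 1\<^sup>2" using e y by (intro power_mono) auto
    hence "((1 + 2 * e) * y)\<^sup>2 * (y ^ 3 / 4) \<le> 1 * (y ^ 3 / 4)"
      using y by (intro mult_right_mono) auto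
    moreover have "((1 + 2 * e) * y)\<^sup>2 * (y ^ 3 / 4) = (1/2 + e)\<^sup>2 * y ^ 5"
      by (simp add: power2_eq_square power3_eq_cube field_simps eval_nat_numeral)
    moreover have "1 * (y ^ 3 / 4) = (1/2 - e)\<^sup>2 * (1 - 2 * e)"
      by (simp add: y_def power2_eq_square power3_eq_cube field_simps)
    ultimately show ?thesis by linarith
  qed
  hence "(1/2 + e)\<^sup>2 * y ^ 5 * exp (M * D) \<le> (1/2 - e)\<^sup>2 * (1 - 2 * e) * exp (M * D)"
    by (intro mult_right_mono) auto
  finally have key: "(1/2 + e)\<^sup>2 * exp (M * (1/2 + e) * D)
      \<le> (1/2 - e)\<^sup>2 * (1 - 2 * e) * exp (M * D)" by simp
  have "c\<^sub>0 * D1\<^sup>2 * exp (M * D1)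
      \<le> c\<^sub>0 * ((1/2 + e) * D)\<^sup>2 * exp (M * ((1/2 + e) * D))"
    using D' D0 M0 assms(2)
    by (intro mult_mono power_mono) (auto simp: D_def D1_def intro!: mult_left_mono)
  also have "\<dots> = c\<^sub>0 * D\<^sup>2 * ((1/2 + e)\<^sup>2 * exp (M * (1/2 + e) * D))"
    by (simp add: power_mult_distrib mult_ac)
  also have "\<dots> \<le> c\<^sub>0 * D\<^sup>2 * ((1/2 - e)\<^sup>2 * (1 - 2 * e) * exp (M * D))"
    using key assms(2) by (intro mult_left_mono) auto
  also have "\<dots> = (1/2 - e)\<^sup>2 * (1 - 2 * e) * (c\<^sub>0 * D\<^sup>2 * exp (M * D))" by (simp add: mult_ac)
  also have "\<dots> \<le> (1/2 - e)\<^sup>2 * (1 - 2 * e) * \<bar>det3 a b c\<bar>"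
    using assms(1) y by (intro mult_left_mono) (auto simp: fat_def D_def y_def)
  also note det'
  finally have "c\<^sub>0 * D1\<^sup>2 * exp (M * D1) \<le> \<bar>det3 a' b' c'\<bar>" .
  moreover have "0 < (1/2 - e)\<^sup>2 * (1 - 2 * e) * \<bar>det3 a b c\<bar>"
    using assms(1) y by (auto simp: fat_def y_def)
  hence "det3 a' b' c' \<noteq> 0" using det' by auto
  ultimately show ?thesis by (simp add: fat_def D1_def)
qed

text \<open>
  For \<open>t \<le> s\<close> the difference of the two points is \<open>t (b - c) + (s - t) (b - a)\<close>, so that the triangle
  inequality yields \<open>s D\<close>. Bounding the two points separately from \<open>a\<close> would only give \<open>(s + t) D\<close>, which is
  too weak to make the inner triangle about half as long.
\<close>

lemma dist_cut_corner:
  fixes a b c :: "'a::real_normed_vector"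
  assumes "0 \<le> s" "0 \<le> t" "s \<le> m" "t \<le> m" "dist a b \<le> D" "dist a c \<le> D" "dist b c \<le> D"
  shows "dist ((1 - s) *\<^sub>R a + s *\<^sub>R b) ((1 - t) *\<^sub>R a + t *\<^sub>R c) \<le> m * D"
proof -
  have main: "dist ((1 - s) *\<^sub>R a + s *\<^sub>R b) ((1 - t) *\<^sub>R a + t *\<^sub>R c) \<le> s * D"
    if "0 \<le> t" "t \<le> s" "dist a b \<le> D" "dist b c \<le> D" for s t :: real and b c :: 'a
  proof -
    have "(1 - s) *\<^sub>R a + s *\<^sub>R b - ((1 - t) *\<^sub>R a + t *\<^sub>R c) = t *\<^sub>R (b - c) + (s - t) *\<^sub>R (b - a)"
      by (simp add: algebra_simps)
    hence "dist ((1 - s) *\<^sub>R a + s *\<^sub>R b) ((1 - t) *\<^sub>R a + t *\<^sub>R c)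
        = norm (t *\<^sub>R (b - c) + (s - t) *\<^sub>R (b - a))" by (simp add: dist_norm)
    also have "\<dots> \<le> norm (t *\<^sub>R (b - c)) + norm ((s - t) *\<^sub>R (b - a))" by (rule norm_triangle_ineq)
    also have "\<dots> = t * dist b c + (s - t) * dist a b"
      using that by (simp add: dist_norm norm_minus_commute)
    also have "\<dots> \<le> t * D + (s - t) * D" using that by (intro add_mono mult_left_mono) auto
    finally show ?thesis by (simp add: algebra_simps)
  qed
  have D: "0 \<le> D" using assms(5) zero_le_dist order_trans by blast
  show ?thesis
  proof (cases "t \<le> s")
    case True
    then show ?thesis using main[of t s b c] assms D mult_right_mono[of s m D] by linarith
  next
    case False
    then show ?thesis using main[of s t c b] assms D mult_right_mono[of t m D]
      by (simp add: dist_commute)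
  qed
qed

lemma dist_cut_edge:
  fixes a b :: "'a::real_normed_vector"
  assumes "0 \<le> s" "s \<le> m" "dist a b \<le> D"
  shows "dist a ((1 - s) *\<^sub>R a + s *\<^sub>R b) \<le> m * D"
proof -
  have "a - ((1 - s) *\<^sub>R a + s *\<^sub>R b) = s *\<^sub>R (a - b)" by (simp add: algebra_simps)
  hence "dist a ((1 - s) *\<^sub>R a + s *\<^sub>R b) = s * dist a b" using assms by (simp add: dist_norm)
  also have "\<dots> \<le> m * D" using assms by (intro mult_mono) auto
  finally show ?thesis .
qed

lemma fat_corner:
  assumes "fat c\<^sub>0 M a b c" "0 \<le> c\<^sub>0" "0 < h" "0 \<le> k" "M = 5 * k / h\<^sup>2"
    and e: "0 \<le> e" "e \<le> k * longest_side a b c" "e \<le> 1/2 - h"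
    and s: "\<bar>s - 1/2\<bar> \<le> e" and t: "\<bar>t - 1/2\<bar> \<le> e"
  shows "fat c\<^sub>0 M a ((1 - s) *\<^sub>R a + s *\<^sub>R b) ((1 - t) *\<^sub>R a + t *\<^sub>R c)"
proof (rule fat_shrink[OF assms(1-5) e])
  have st: "1/2 - e \<le> s" "s \<le> 1/2 + e" "1/2 - e \<le> t" "t \<le> 1/2 + e" "0 \<le> 1/2 - e"
    using s t e assms(3) by (auto simp: abs_le_iff)
  let ?b = "(1 - s) *\<^sub>R a + s *\<^sub>R b" and ?c = "(1 - t) *\<^sub>R a + t *\<^sub>R c"
  let ?D = "longest_side a b c"
  have D: "dist a b \<le> ?D" "dist a c \<le> ?D" "dist b c \<le> ?D"
    using side_le_longest_side[of b c a] side_le_longest_side[of c a b]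
      side_le_longest_side[of a b c] by (simp_all add: dist_commute)
  have "dist ?b ?c \<le> (1/2 + e) * ?D" using st D by (intro dist_cut_corner) auto
  moreover have "dist a ?b \<le> (1/2 + e) * ?D" "dist a ?c \<le> (1/2 + e) * ?D"
    using st D by (auto intro!: dist_cut_edge)
  ultimately show "longest_side a ?b ?c \<le> (1/2 + e) * ?D"
    by (simp add: longest_side_def dist_commute)
  have "(1/2 - e) * (1/2 - e) * (1 - 2 * e) \<le> (s * t) * 1"
    using st e by (intro mult_mono) auto
  hence "(1/2 - e)\<^sup>2 * (1 - 2 * e) * \<bar>det3 a b c\<bar> \<le> s * t * \<bar>det3 a b c\<bar>"
    by (intro mult_right_mono) (auto simp: power2_eq_square)
  also have "\<dots> = \<bar>det3 a ?b ?c\<bar>" using st by (simp add: det3_corner abs_mult)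
  finally show "(1/2 - e)\<^sup>2 * (1 - 2 * e) * \<bar>det3 a b c\<bar> \<le> \<bar>det3 a ?b ?c\<bar>" .
qed

text \<open>
  Each side of the inner triangle is the third side of a corner triangle, and its determinant is the
  original one times \<open>p q r + (1 - p)(1 - q)(1 - r)\<close>, which is 1/4 when all ratios are 1/2.
\<close>

lemma fat_inner_triangle:
  assumes "fat c\<^sub>0 M a b c" "0 \<le> c\<^sub>0" "0 < h" "0 \<le> k" "M = 5 * k / h\<^sup>2"
    and e: "0 \<le> e" "e \<le> k * longest_side a b c" "e \<le> 1/2 - h"
    and p: "\<bar>p - 1/2\<bar> \<le> e" and q: "\<bar>q - 1/2\<bar> \<le> e" and r: "\<bar>r - 1/2\<bar> \<le> e"
  shows "fat c\<^sub>0 M ((1 - p) *\<^sub>R b + p *\<^sub>R c) ((1 - q) *\<^sub>R c + q *\<^sub>R a) ((1 - r) *\<^sub>R a + r *\<^sub>R b)"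
    (is "fat _ _ ?a ?b ?c")
proof (rule fat_shrink[OF assms(1-5) e])
  have pqr: "1/2 - e \<le> p" "p \<le> 1/2 + e" "1/2 - e \<le> q" "q \<le> 1/2 + e"
    "1/2 - e \<le> r" "r \<le> 1/2 + e" "0 \<le> 1/2 - e"
    using p q r e assms(3) by (auto simp: abs_le_iff)
  let ?D = "longest_side a b c"
  have D: "dist a b \<le> ?D" "dist a c \<le> ?D" "dist b c \<le> ?D" "dist b a \<le> ?D" "dist c a \<le> ?D"
    "dist c b \<le> ?D"
    using side_le_longest_side[of b c a] side_le_longest_side[of c a b]
      side_le_longest_side[of a b c] by (simp_all add: dist_commute)
  have "dist ((1 - p) *\<^sub>R b + p *\<^sub>R c) ((1 - (1 - r)) *\<^sub>R b + (1 - r) *\<^sub>R a) \<le> (1/2 + e) * ?D"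
    using pqr D by (intro dist_cut_corner) auto
  moreover have "dist ((1 - q) *\<^sub>R c + q *\<^sub>R a) ((1 - (1 - p)) *\<^sub>R c + (1 - p) *\<^sub>R b) \<le> (1/2 + e) * ?D"
    using pqr D by (intro dist_cut_corner) auto
  moreover have "dist ((1 - r) *\<^sub>R a + r *\<^sub>R b) ((1 - (1 - q)) *\<^sub>R a + (1 - q) *\<^sub>R c) \<le> (1/2 + e) * ?D"
    using pqr D by (intro dist_cut_corner) auto
  ultimately show "longest_side ?a ?b ?c \<le> (1/2 + e) * ?D"
    by (simp add: longest_side_def dist_commute add.commute)
  have "(1/2 - e) * (1/2 - e) * (1/2 - e) \<le> p * q * r"
    "(1/2 - e) * (1/2 - e) * (1/2 - e) \<le> (1 - p) * (1 - q) * (1 - r)"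
    using pqr by (auto intro!: mult_mono)
  hence "(1/2 - e)\<^sup>2 * (1 - 2 * e) \<le> p * q * r + (1 - p) * (1 - q) * (1 - r)"
    by (simp add: power2_eq_square algebra_simps)
  moreover have "0 \<le> (1/2 - e)\<^sup>2 * (1 - 2 * e)" using pqr by simp
  ultimately have "(1/2 - e)\<^sup>2 * (1 - 2 * e) * \<bar>det3 a b c\<bar> \<le>
      \<bar>p * q * r + (1 - p) * (1 - q) * (1 - r)\<bar> * \<bar>det3 a b c\<bar>"
    by (intro mult_right_mono) auto
  thus "(1/2 - e)\<^sup>2 * (1 - 2 * e) * \<bar>det3 a b c\<bar> \<le> \<bar>det3 ?a ?b ?c\<bar>"
    by (simp add: det3_inner_triangle abs_mult)
qed

section \<open>Generalized trigonometric functions\<close>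

text \<open>
  A uniform notation for the three geometries: the solutions of \<open>f'' = - \<kappa> f\<close> with the initial data of
  sine and cosine, so that the point at distance \<open>t\<close> from \<open>p\<close> in the unit direction \<open>v\<close> is
  \<open>cs t p + sn t v\<close>.
\<close>

definition sn :: "real \<Rightarrow> real \<Rightarrow> real" where
  "sn \<kappa> t = (if \<kappa> < 0 then sinh (sqrt (- \<kappa>) * t) / sqrt (- \<kappa>)
             else if \<kappa> = 0 then t else sin (sqrt \<kappa> * t) / sqrt \<kappa>)"

definition cs :: "real \<Rightarrow> real \<Rightarrow> real" where
  "cs \<kappa> t = (if \<kappa> < 0 then cosh (sqrt (- \<kappa>) * t)
             else if \<kappa> = 0 then 1 else cos (sqrt \<kappa> * t))"

lemma sn_0 [simp]: "sn \<kappa> 0 = 0" and cs_0 [simp]: "cs \<kappa> 0 = 1"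
  and sn_flat [simp]: "sn 0 t = t" and cs_flat [simp]: "cs 0 t = 1"
  by (auto simp: sn_def cs_def)

lemma cs_sn_pythagoras: "(cs \<kappa> t)\<^sup>2 + \<kappa> * (sn \<kappa> t)\<^sup>2 = 1"
  by (auto simp: sn_def cs_def cosh_square_eq power_divide)

lemma sn_diff: "sn \<kappa> (s - t) = sn \<kappa> s * cs \<kappa> t - cs \<kappa> s * sn \<kappa> t"
  by (auto simp: sn_def cs_def sinh_diff sin_diff algebra_simps diff_divide_distrib)

lemma cs_diff: "cs \<kappa> (s - t) = cs \<kappa> s * cs \<kappa> t + \<kappa> * sn \<kappa> s * sn \<kappa> t"
  by (auto simp: sn_def cs_def cosh_diff cos_diff algebra_simps divide_simps)

lemma sn_has_real_derivative: "(sn \<kappa> has_real_derivative cs \<kappa> t) (at t)"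
proof -
  consider "\<kappa> < 0" | "\<kappa> = 0" | "\<kappa> > 0" by linarith
  then show ?thesis
  proof cases
    case 1
    define k where "k = sqrt (- \<kappa>)"
    have "sn \<kappa> = (\<lambda>t. sinh (k * t) / k)" "cs \<kappa> t = cosh (k * t)" "k \<noteq> 0"
      using 1 by (auto simp: sn_def cs_def k_def)
    then show ?thesis by (auto intro!: derivative_eq_intros)
  next
    case 2
    then have "sn \<kappa> = (\<lambda>t. t)" by (auto simp: sn_def)
    then show ?thesis using 2 by (auto simp: cs_def intro!: derivative_eq_intros)
  next
    case 3
    define k where "k = sqrt \<kappa>"
    have "sn \<kappa> = (\<lambda>t. sin (k * t) / k)" "cs \<kappa> t = cos (k * t)" "k \<noteq> 0"
      using 3 by (auto simp: sn_def cs_def k_def)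
    then show ?thesis by (auto intro!: derivative_eq_intros)
  qed
qed

lemma continuous_on_sn [continuous_intros]:
  "continuous_on A f \<Longrightarrow> continuous_on A (\<lambda>x. sn \<kappa> (f x))"
  using continuous_on_compose2[of UNIV "sn \<kappa>" A f]
    DERIV_continuous_on[of UNIV "sn \<kappa>" "cs \<kappa>"] sn_has_real_derivative
  by (auto intro: has_field_derivative_at_within)

lemma sn_pos:
  assumes "0 < t" "\<kappa> > 0 \<Longrightarrow> sqrt \<kappa> * t < pi"
  shows "0 < sn \<kappa> t"
  using assms by (auto simp: sn_def not_less intro!: divide_pos_pos sin_gt_zero)

lemma sn_nonneg:
  assumes "0 \<le> t" "\<kappa> > 0 \<Longrightarrow> sqrt \<kappa> * t \<le> pi"
  shows "0 \<le> sn \<kappa> t"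
  using assms by (auto simp: sn_def not_less intro!: divide_nonneg_pos sin_ge_zero)

section \<open>The ambient bilinear form and the distance\<close>

lemma model_form_coords:
  "model_form \<kappa> x y = x$1 * y$1 + x$2 * y$2 + (if \<kappa> < 0 then - 1 else 1) * (x$3 * y$3)"
  by (simp add: model_form_def inner_real3)

lemma model_form_commute: "model_form \<kappa> x y = model_form \<kappa> y x"
  by (simp add: model_form_coords algebra_simps)

lemma model_form_linear:
  "model_form \<kappa> (x + y) z = model_form \<kappa> x z + model_form \<kappa> y z"
  "model_form \<kappa> z (x + y) = model_form \<kappa> z x + model_form \<kappa> z y"
  "model_form \<kappa> (x - y) z = model_form \<kappa> x z - model_form \<kappa> y z"
  "model_form \<kappa> z (x - y) = model_form \<kappa> z x - model_form \<kappa> z y"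
  "model_form \<kappa> (r *\<^sub>R x) z = r * model_form \<kappa> x z"
  "model_form \<kappa> z (r *\<^sub>R x) = r * model_form \<kappa> z x"
  by (auto simp: model_form_coords algebra_simps)

lemma abs_model_form_le: "\<bar>model_form \<kappa> x y\<bar> \<le> norm x * norm y"
proof (cases "\<kappa> < 0")
  case True
  define y' :: "real^3" where "y' = (\<chi> i. if i = 3 then - y$3 else y$i)"
  have "model_form \<kappa> x y = x \<bullet> y'" using True
    by (simp add: model_form_coords inner_real3 y'_def)
  moreover have "norm y' = norm y"
    by (simp add: norm_eq_sqrt_inner inner_real3 y'_def)
  ultimately show ?thesis using Cauchy_Schwarz_ineq2[of x y'] by simp
qed (simp add: model_form_def Cauchy_Schwarz_ineq2)

lemma model_form_self:
  assumes "x \<in> model_surface \<kappa>" "\<kappa> \<noteq> 0"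
  shows "\<kappa> * model_form \<kappa> x x = 1"
proof (cases "\<kappa> < 0")
  case True
  then show ?thesis using assms by (auto simp: model_surface_def)
next
  case False
  then have "norm x = 1 / sqrt \<kappa>" using assms by (auto simp: model_surface_def)
  then have "x \<bullet> x = 1 / \<kappa>" using False by (simp add: dot_square_norm power_divide)
  then show ?thesis using False assms by (simp add: model_form_def)
qed

lemma model_surfaceI:
  assumes "\<kappa> * model_form \<kappa> x x = 1" "\<kappa> < 0 \<Longrightarrow> 0 < x$3"
  shows "x \<in> model_surface \<kappa>"
proof (cases "\<kappa> < 0")
  case True
  then show ?thesis using assms by (auto simp: model_surface_def field_simps)
next
  case False
  moreover from assms have "\<kappa> \<noteq> 0" by auto
  ultimately have k: "\<kappa> > 0" by simp
  then have "x \<bullet> x = 1 / \<kappa>" using assms by (simp add: model_form_def field_simps)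
  then have "norm x = 1 / sqrt \<kappa>" by (simp add: norm_eq_sqrt_inner real_sqrt_divide)
  then show ?thesis using k by (simp add: model_surface_def)
qed

text \<open>
  Writing \<open>R = - 1/\<kappa>\<close> and \<open>g = R + x\<^sub>1 y\<^sub>1 + x\<^sub>2 y\<^sub>2\<close>, the difference of squares
  \<open>(x\<^sub>3 y\<^sub>3)\<^sup>2 - g\<^sup>2\<close> is a sum of squares that vanishes only for \<open>x = y\<close>.
\<close>

lemma hyperbolic_reversed_Cauchy_Schwarz:
  assumes "x \<in> model_surface \<kappa>" "y \<in> model_surface \<kappa>" "\<kappa> < 0"
  shows "1 \<le> \<kappa> * model_form \<kappa> x y" "\<kappa> * model_form \<kappa> x y = 1 \<Longrightarrow> x = y"
proof -
  define R where "R = - 1 / \<kappa>"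
  have R: "R > 0" using assms(3) by (simp add: R_def divide_neg_neg)
  define g where "g = R + x$1 * y$1 + x$2 * y$2"
  have x: "(x$3)\<^sup>2 = R + (x$1)\<^sup>2 + (x$2)\<^sup>2" "x$3 > 0" and y: "(y$3)\<^sup>2 = R + (y$1)\<^sup>2 + (y$2)\<^sup>2" "y$3 > 0"
    using assms by (auto simp: model_surface_def model_form_coords R_def power2_eq_square)
  have eq: "(x$3 * y$3)\<^sup>2 = g\<^sup>2 + R * ((x$1 - y$1)\<^sup>2 + (x$2 - y$2)\<^sup>2) + (x$1 * y$2 - x$2 * y$1)\<^sup>2"
    unfolding power_mult_distrib x y g_def by (simp add: power2_eq_square algebra_simps)
  have "g\<^sup>2 \<le> (x$3 * y$3)\<^sup>2" unfolding eq using R by simp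
  then have "g \<le> x$3 * y$3" by (rule power2_le_imp_le) (use x(2) y(2) in simp)
  moreover have form: "\<kappa> * model_form \<kappa> x y = 1 + (- \<kappa>) * (x$3 * y$3 - g)"
    using assms(3) by (simp add: model_form_coords g_def R_def field_simps)
  ultimately show "1 \<le> \<kappa> * model_form \<kappa> x y" using assms(3) by (simp add: mult_nonpos_nonneg)
  assume "\<kappa> * model_form \<kappa> x y = 1"
  then have "x$3 * y$3 = g" using form assms(3) by simp
  with eq have "R * ((x$1 - y$1)\<^sup>2 + (x$2 - y$2)\<^sup>2) + (x$1 * y$2 - x$2 * y$1)\<^sup>2 = 0" by simp
  moreover have "0 \<le> R * ((x$1 - y$1)\<^sup>2 + (x$2 - y$2)\<^sup>2)" using R by simp
  ultimately have "R * ((x$1 - y$1)\<^sup>2 + (x$2 - y$2)\<^sup>2) = 0"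
    by (smt (verit) zero_le_power2)
  then have 12: "x$1 = y$1" "x$2 = y$2" using R by (auto simp: sum_power2_eq_zero_iff)
  then have "(x$3)\<^sup>2 = (y$3)\<^sup>2" using x(1) y(1) by simp
  then have "x$3 = y$3" using x(2) y(2) by (simp add: power2_eq_iff_nonneg)
  then show "x = y" using 12 by (simp add: vec_eq_iff forall_3)
qed

lemma spherical_form_bound:
  assumes "x \<in> model_surface \<kappa>" "y \<in> model_surface \<kappa>" "\<kappa> > 0"
  shows "\<bar>\<kappa> * model_form \<kappa> x y\<bar> \<le> 1"
proof -
  have "norm x = 1 / sqrt \<kappa>" "norm y = 1 / sqrt \<kappa>" using assms by (auto simp: model_surface_def)
  then have "\<bar>model_form \<kappa> x y\<bar> \<le> 1 / \<kappa>" using abs_model_form_le[of \<kappa> x y] assms by simp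
  then show ?thesis using assms by (simp add: abs_mult field_simps)
qed

text \<open>
  This equality case of the Cauchy--Schwarz inequality, direct or reversed, takes the place of a
  discussion of the strict triangle inequality: for \<open>\<kappa> \<noteq> 0\<close> it yields both the separation of points
  by the distance and the uniqueness of geodesics.
\<close>

lemma model_surface_eqI:
  assumes "x \<in> model_surface \<kappa>" "y \<in> model_surface \<kappa>" "\<kappa> * model_form \<kappa> x y = 1"
  shows "x = y"
proof (cases "\<kappa> < 0")
  case True
  then show ?thesis using hyperbolic_reversed_Cauchy_Schwarz[OF assms(1,2)] assms(3) by simp
next
  case False
  moreover from assms have "\<kappa> \<noteq> 0" by auto
  ultimately have k: "\<kappa> > 0" by simp
  have "\<kappa> * model_form \<kappa> (x - y) (x - y) = 0"
    using model_form_self[OF assms(1)] model_form_self[OF assms(2)] assms(3) k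
    by (simp add: model_form_linear model_form_commute[of \<kappa> y x] algebra_simps)
  then show ?thesis using k by (simp add: model_form_def)
qed

lemma model_dist_commute: "model_dist \<kappa> x y = model_dist \<kappa> y x"
  by (simp add: model_dist_def model_form_commute dist_commute)

lemma model_dist_nonneg:
  assumes "x \<in> model_surface \<kappa>" "y \<in> model_surface \<kappa>"
  shows "0 \<le> model_dist \<kappa> x y"
  using hyperbolic_reversed_Cauchy_Schwarz(1)[OF assms] spherical_form_bound[OF assms]
  by (auto simp: model_dist_def not_less abs_le_iff intro!: divide_nonneg_pos arccos_lbound)

lemma model_dist_le_pi:
  assumes "x \<in> model_surface \<kappa>" "y \<in> model_surface \<kappa>" "\<kappa> > 0"
  shows "sqrt \<kappa> * model_dist \<kappa> x y \<le> pi"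
  using spherical_form_bound[OF assms] assms(3)
  by (auto simp: model_dist_def abs_le_iff intro!: arccos_ubound)

lemma cs_model_dist:
  assumes "x \<in> model_surface \<kappa>" "y \<in> model_surface \<kappa>" "\<kappa> \<noteq> 0"
  shows "cs \<kappa> (model_dist \<kappa> x y) = \<kappa> * model_form \<kappa> x y"
  using hyperbolic_reversed_Cauchy_Schwarz(1)[OF assms(1,2)] spherical_form_bound[OF assms(1,2)] assms(3)
  by (auto simp: model_dist_def cs_def not_less abs_le_iff)

lemma sn_nonneg_upto_dist:
  assumes "x \<in> model_surface \<kappa>" "y \<in> model_surface \<kappa>" "0 \<le> t" "t \<le> model_dist \<kappa> x y"
  shows "0 \<le> sn \<kappa> t"
proof (rule sn_nonneg)
  assume "\<kappa> > 0"
  then have "sqrt \<kappa> * t \<le> sqrt \<kappa> * model_dist \<kappa> x y" using assms by simp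
  also have "\<dots> \<le> pi" using model_dist_le_pi assms \<open>\<kappa> > 0\<close> by blast
  finally show "sqrt \<kappa> * t \<le> pi" .
qed fact

lemma model_dist_pos:
  assumes x: "x \<in> model_surface \<kappa>" and y: "y \<in> model_surface \<kappa>" and "x \<noteq> y"
    and hemisphere: "\<kappa> > 0 \<Longrightarrow> 0 < u \<bullet> x \<and> 0 < u \<bullet> y"
  shows "0 < model_dist \<kappa> x y" "0 < sn \<kappa> (model_dist \<kappa> x y)"
proof -
  have ne: "model_dist \<kappa> x y \<noteq> 0"
  proof
    assume d: "model_dist \<kappa> x y = 0"
    show False
    proof (cases "\<kappa> = 0")
      case True
      then show False using d \<open>x \<noteq> y\<close> by (simp add: model_dist_def)
    next
      case False
      then show False using cs_model_dist[OF x y] d model_surface_eqI[OF x y] \<open>x \<noteq> y\<close> by simp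
    qed
  qed
  then show pos: "0 < model_dist \<kappa> x y" using model_dist_nonneg[OF x y] by simp
  show "0 < sn \<kappa> (model_dist \<kappa> x y)"
  proof (rule sn_pos[OF pos])
    assume k: "\<kappa> > 0"
    \<comment> \<open>Distance \<open>pi / sqrt \<kappa>\<close> means antipodal, which an open hemisphere excludes.\<close>
    have "sqrt \<kappa> * model_dist \<kappa> x y \<noteq> pi"
    proof
      assume "sqrt \<kappa> * model_dist \<kappa> x y = pi"
      then have "cs \<kappa> (model_dist \<kappa> x y) = - 1" using k by (simp add: cs_def)
      then have "\<kappa> * model_form \<kappa> x y = - 1" using cs_model_dist[OF x y] k by simp
      then have "\<kappa> * model_form \<kappa> x (- y) = 1" using k by (simp add: model_form_def)
      moreover have "- y \<in> model_surface \<kappa>" using y k by (simp add: model_surface_def)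
      ultimately have "x = - y" using model_surface_eqI[OF x] by blast
      then have "u \<bullet> x = - (u \<bullet> y)" by simp
      then show False using hemisphere[OF k] by linarith
    qed
    then show "sqrt \<kappa> * model_dist \<kappa> x y < pi" using model_dist_le_pi[OF x y k] by simp
  qed
qed

section \<open>Geodesic segments\<close>

text \<open>
  Uniqueness of geodesics. For \<open>\<kappa> \<noteq> 0\<close> the right-hand side \<open>y\<close> has the same products with \<open>p\<close> and \<open>q\<close> as \<open>x\<close>,
  since these are determined by the distances. Because \<open>y\<close> lies in the span of \<open>p\<close> and \<open>q\<close>, it
  follows that \<open>\<langle>y|x\<rangle> = \<langle>y|y\<rangle> = 1/\<kappa>\<close>, which forces \<open>x = y\<close>. For \<open>\<kappa> = 0\<close> the claim is Stewart's theorem.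
\<close>

lemma point_on_geodesic:
  assumes p: "p \<in> model_surface \<kappa>" and q: "q \<in> model_surface \<kappa>" and x: "x \<in> model_surface \<kappa>"
    and L: "L = model_dist \<kappa> p q" "0 < L" "0 < sn \<kappa> L"
    and t: "0 \<le> t" "t \<le> L" "model_dist \<kappa> p x = t" "model_dist \<kappa> x q = L - t"
  shows "x = (sn \<kappa> (L - t) / sn \<kappa> L) *\<^sub>R p + (sn \<kappa> t / sn \<kappa> L) *\<^sub>R q"
proof (cases "\<kappa> = 0")
  case True
  define r where "r = t / L"
  have r: "t = r * L" using L by (simp add: r_def)
  have d: "norm (x - p) = r * L" "norm (x - q) = (1 - r) * L" "norm (p - q) = L"
    using t L True by (simp_all add: r model_dist_def dist_norm norm_minus_commute algebra_simps)
  \<comment> \<open>Stewart's theorem, with \<open>r\<close> the ratio in which \<open>x\<close> should divide the segment.\<close>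
  have "(norm (x - ((1 - r) *\<^sub>R p + r *\<^sub>R q)))\<^sup>2
      = (1 - r) * (norm (x - p))\<^sup>2 + r * (norm (x - q))\<^sup>2 - r * (1 - r) * (norm (p - q))\<^sup>2"
    unfolding dot_square_norm[symmetric]
    by (simp add: inner_diff inner_add inner_commute algebra_simps)
  also have "\<dots> = 0" unfolding d by (simp add: power2_eq_square algebra_simps)
  finally have "x = (1 - r) *\<^sub>R p + r *\<^sub>R q" by simp
  moreover have "(L - t) / L = 1 - r" using L by (simp add: r_def field_simps)
  ultimately show ?thesis using True by (simp add: r_def)
next
  case False
  define y where "y = (sn \<kappa> (L - t) / sn \<kappa> L) *\<^sub>R p + (sn \<kappa> t / sn \<kappa> L) *\<^sub>R q"
  let ?f = "\<lambda>x y. \<kappa> * model_form \<kappa> x y"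
  let ?s = "sn \<kappa> L" and ?c = "cs \<kappa> L" and ?s1 = "sn \<kappa> t" and ?c1 = "cs \<kappa> t"
  have s: "?s \<noteq> 0" using L by simp
  have py: "?c\<^sup>2 = 1 - \<kappa> * ?s\<^sup>2" "?c1\<^sup>2 = 1 - \<kappa> * ?s1\<^sup>2"
    using cs_sn_pythagoras[of \<kappa> L] cs_sn_pythagoras[of \<kappa> t] by simp_all
  have self: "?f p p = 1" "?f q q = 1" "?f x x = 1"
    using model_form_self p q x False by blast+
  have pq: "?f p q = ?c" "?f q p = ?c" using cs_model_dist[OF p q False] L
    by (simp_all add: model_form_commute)
  have px: "?f p x = ?c1" using cs_model_dist[OF p x False] t by simp
  have qx: "?f q x = ?c * ?c1 + \<kappa> * ?s * ?s1"
    using cs_model_dist[OF x q False] t by (simp add: model_form_commute cs_diff)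
  have ny: "?s *\<^sub>R y = (?s * ?c1 - ?c * ?s1) *\<^sub>R p + ?s1 *\<^sub>R q"
    using s by (simp add: y_def sn_diff scaleR_right_distrib)
  have fy: "?s * ?f y z = (?s * ?c1 - ?c * ?s1) * ?f p z + ?s1 * ?f q z" for z
  proof -
    have "?s * ?f y z = ?f (?s *\<^sub>R y) z" by (simp add: model_form_linear)
    also have "\<dots> = (?s * ?c1 - ?c * ?s1) * ?f p z + ?s1 * ?f q z"
      unfolding ny by (simp add: model_form_linear algebra_simps)
    finally show ?thesis .
  qed
  have yp: "?f y p = ?c1" using fy[of p] s self pq by (simp add: algebra_simps)
  have "?s * ?f y q = ?s * (?c * ?c1 + \<kappa> * ?s * ?s1)"
    unfolding fy self pq using py by algebra
  then have yq: "?f y q = ?c * ?c1 + \<kappa> * ?s * ?s1" using s by simp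
  have one: "(?s * ?c1 - ?c * ?s1) * ?c1 + ?s1 * (?c * ?c1 + \<kappa> * ?s * ?s1) = ?s"
    using py(2) by algebra
  have "?s * ?f y x = ?s" unfolding fy px qx by (rule one)
  then have yx: "?f y x = 1" using s by simp
  have "?s * ?f y y = ?s" unfolding fy using yp yq one by (simp add: model_form_commute)
  then have yy: "?f y y = 1" using s by simp
  have "y \<in> model_surface \<kappa>"
  proof (rule model_surfaceI[OF yy])
    assume k: "\<kappa> < 0"
    then have pos: "p$3 > 0" "q$3 > 0" using p q by (auto simp: model_surface_def)
    have "0 \<le> sn \<kappa> (L - t)" "0 \<le> sn \<kappa> t" using t k by (auto intro!: sn_nonneg)
    moreover have "0 < sn \<kappa> (L - t) \<or> 0 < sn \<kappa> t" using L t k sn_pos[of "L - t" \<kappa>] sn_pos[of t \<kappa>]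
      by (smt (verit))
    ultimately have "0 < sn \<kappa> (L - t) * p$3 + sn \<kappa> t * q$3"
      using pos by (metis add_nonneg_pos add_pos_nonneg less_imp_le mult_nonneg_nonneg mult_pos_pos)
    moreover have "y$3 = (sn \<kappa> (L - t) * p$3 + sn \<kappa> t * q$3) / sn \<kappa> L"
      by (simp add: y_def add_divide_distrib)
    ultimately show "0 < y$3" using L by simp
  qed
  then have "y = x" using model_surface_eqI x yx by blast
  then show ?thesis by (simp add: y_def)
qed

lemma geodesic_path_dist:
  assumes "geodesic_path \<kappa> p q c" "0 \<le> t" "t \<le> model_dist \<kappa> p q"
  shows "model_dist \<kappa> p (c t) = t" "model_dist \<kappa> (c t) q = model_dist \<kappa> p q - t"
    "c t \<in> model_surface \<kappa>"
proof -
  let ?L = "model_dist \<kappa> p q"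
  have c: "c 0 = p" "c ?L = q" "c ` {0..?L} \<subseteq> model_surface \<kappa>"
    and iso: "\<And>s t. \<lbrakk>s \<in> {0..?L}; t \<in> {0..?L}\<rbrakk> \<Longrightarrow> model_dist \<kappa> (c s) (c t) = \<bar>s - t\<bar>"
    using assms(1) unfolding geodesic_path_def by blast+
  show "model_dist \<kappa> p (c t) = t" using iso[of 0 t] assms c by simp
  show "model_dist \<kappa> (c t) q = ?L - t" using iso[of t ?L] assms c by simp
  show "c t \<in> model_surface \<kappa>" using assms c by auto
qed

lemma geodesic_path_reverse:
  assumes "geodesic_path \<kappa> p q c"
  shows "geodesic_path \<kappa> q p (\<lambda>t. c (model_dist \<kappa> p q - t))"
  using assms unfolding geodesic_path_def by (auto simp: model_dist_commute[of \<kappa> q p])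

lemma geodesic_segment_commute:
  assumes "geodesic_segment \<kappa> p q S"
  shows "geodesic_segment \<kappa> q p S"
proof -
  let ?L = "model_dist \<kappa> p q"
  obtain c where c: "geodesic_path \<kappa> p q c" "S = c ` {0..?L}"
    using assms by (auto simp: geodesic_segment_def)
  have "(\<lambda>t. c (?L - t)) ` {0..?L} = c ` ((\<lambda>t. ?L - t) ` {0..?L})"
    by (rule image_image[symmetric])
  also have "(\<lambda>t. ?L - t) ` {0..?L} = {0..?L}" by simp
  finally show ?thesis using c geodesic_path_reverse[OF c(1)] assms
    unfolding geodesic_segment_def model_dist_commute[of \<kappa> q p] by metis
qed

lemma segment_midpoint_commute: "segment_midpoint \<kappa> p q S = segment_midpoint \<kappa> q p S"
proof -
  have "model_dist \<kappa> p m = model_dist \<kappa> m q \<longleftrightarrow> model_dist \<kappa> q m = model_dist \<kappa> m p" for m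
    using model_dist_commute[of \<kappa> p m] model_dist_commute[of \<kappa> m q] by auto
  then show ?thesis by (simp add: segment_midpoint_def)
qed

lemma arclength_param_path:
  assumes "geodesic_path \<kappa> p q c" "0 \<le> t" "t \<le> model_dist \<kappa> p q"
  shows "arclength_param \<kappa> p (c ` {0..model_dist \<kappa> p q}) t = c t"
  unfolding arclength_param_def using assms geodesic_path_dist[OF assms(1)]
  by (intro the_equality) auto

lemma segment_midpoint_path:
  assumes "geodesic_path \<kappa> p q c" "0 \<le> model_dist \<kappa> p q"
  shows "segment_midpoint \<kappa> p q (c ` {0..model_dist \<kappa> p q}) = c (model_dist \<kappa> p q / 2)"
  unfolding segment_midpoint_def
proof (intro the_equality conjI)
  let ?L = "model_dist \<kappa> p q"
  show "c (?L / 2) \<in> c ` {0..?L}" using assms by simp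
  show "model_dist \<kappa> p (c (?L / 2)) = model_dist \<kappa> (c (?L / 2)) q"
    using geodesic_path_dist[OF assms(1), of "?L / 2"] assms by simp
  fix m assume m: "m \<in> c ` {0..?L} \<and> model_dist \<kappa> p m = model_dist \<kappa> m q"
  then obtain t where t: "m = c t" "0 \<le> t" "t \<le> ?L" by auto
  then have "t = ?L - t" using geodesic_path_dist[OF assms(1), of t] m by simp
  then have "t = ?L / 2" by simp
  then show "m = c (?L / 2)" using t(1) by (simp only:)
qed

lemma subsegment_path:
  assumes "geodesic_path \<kappa> p q c" "0 \<le> t" "t \<le> model_dist \<kappa> p q"
  shows "subsegment \<kappa> p (c t) (c ` {0..model_dist \<kappa> p q}) = c ` {0..t}"
  using assms geodesic_path_dist[OF assms(1)] unfolding subsegment_def by auto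

text \<open>
  The outer edges of the corner triangles are again geodesic segments. Segments are oriented by their first end
  point, so the other half of an edge is reached through \<open>geodesic_segment_commute\<close> and
  \<open>segment_midpoint_commute\<close>.
\<close>

lemma geodesic_segment_half:
  assumes "geodesic_segment \<kappa> p q S"
  shows "geodesic_segment \<kappa> p (segment_midpoint \<kappa> p q S)
           (subsegment \<kappa> p (segment_midpoint \<kappa> p q S) S)"
proof -
  let ?L = "model_dist \<kappa> p q"
  obtain c where c: "geodesic_path \<kappa> p q c" "S = c ` {0..?L}"
    and pq: "p \<in> model_surface \<kappa>" "q \<in> model_surface \<kappa>"
    using assms by (auto simp: geodesic_segment_def)
  have L: "0 \<le> ?L" using model_dist_nonneg pq by blast
  define m where "m = segment_midpoint \<kappa> p q S"
  have m: "m = c (?L / 2)" using segment_midpoint_path[OF c(1) L] c(2) by (simp add: m_def)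
  have d: "model_dist \<kappa> p m = ?L / 2" using geodesic_path_dist(1)[OF c(1)] L m by simp
  have "subsegment \<kappa> p m S = c ` {0..?L / 2}"
    using subsegment_path[OF c(1), of "?L / 2"] L by (simp add: m c(2))
  moreover have "geodesic_path \<kappa> p m c"
    using c(1) L unfolding geodesic_path_def d by (auto simp: m)
  moreover have "m \<in> model_surface \<kappa>" using geodesic_path_dist(3)[OF c(1)] L m by simp
  ultimately have "geodesic_segment \<kappa> p m (subsegment \<kappa> p m S)"
    using pq unfolding geodesic_segment_def d by blast
  then show ?thesis by (simp add: m_def)
qed

lemma geodesic_path_formula:
  assumes "geodesic_path \<kappa> p q c" "p \<in> model_surface \<kappa>" "q \<in> model_surface \<kappa>"
    and L: "L = model_dist \<kappa> p q" "0 < L" "0 < sn \<kappa> L" and t: "0 \<le> t" "t \<le> L"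
  shows "c t = (sn \<kappa> (L - t) / sn \<kappa> L) *\<^sub>R p + (sn \<kappa> t / sn \<kappa> L) *\<^sub>R q"
  using geodesic_path_dist[OF assms(1), of t] assms by (intro point_on_geodesic) auto

lemma initial_velocity_eq:
  assumes S: "geodesic_segment \<kappa> p q S"
    and L: "L = model_dist \<kappa> p q" "0 < L" "0 < sn \<kappa> L"
  shows "initial_velocity \<kappa> p S = (1 / sn \<kappa> L) *\<^sub>R (q - cs \<kappa> L *\<^sub>R p)"
proof -
  obtain c where c: "geodesic_path \<kappa> p q c" "S = c ` {0..L}"
    and pq: "p \<in> model_surface \<kappa>" "q \<in> model_surface \<kappa>"
    using S L by (auto simp: geodesic_segment_def)
  define f where "f t = (sn \<kappa> (L - t) / sn \<kappa> L) *\<^sub>R p + (sn \<kappa> t / sn \<kappa> L) *\<^sub>R q" for t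
  have f: "arclength_param \<kappa> p S t = f t" if "0 \<le> t" "t \<le> L" for t
    using arclength_param_path[OF c(1)] geodesic_path_formula[OF c(1) pq L] that L
    by (simp add: f_def c(2))
  \<comment> \<open>The parametrization agrees with \<open>f\<close> on \<open>{0..L}\<close>; a neighbourhood including 0 is what the transfer of the derivative asks for, and the restriction to \<open>t > 0\<close> follows.\<close>
  have 1: "((\<lambda>t. sn \<kappa> (L - t) / sn \<kappa> L) has_real_derivative - cs \<kappa> L / sn \<kappa> L) (at 0 within {0..})"
    using L by (auto intro!: derivative_eq_intros DERIV_chain2[OF sn_has_real_derivative])
  have 2: "((\<lambda>t. sn \<kappa> t / sn \<kappa> L) has_real_derivative 1 / sn \<kappa> L) (at 0 within {0..})"
    using L by (auto intro!: derivative_eq_intros DERIV_chain2[OF sn_has_real_derivative])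
  have "(f has_vector_derivative ((- cs \<kappa> L / sn \<kappa> L) *\<^sub>R p + (1 / sn \<kappa> L) *\<^sub>R q)) (at 0 within {0..})"
    unfolding f_def
    using has_vector_derivative_add[OF has_vector_derivative_scaleR[OF 1 has_vector_derivative_const]
        has_vector_derivative_scaleR[OF 2 has_vector_derivative_const]] by simp
  then have "(arclength_param \<kappa> p S has_vector_derivative
      ((- cs \<kappa> L / sn \<kappa> L) *\<^sub>R p + (1 / sn \<kappa> L) *\<^sub>R q)) (at 0 within {0..})"
    by (rule has_vector_derivative_transform_within[OF _ L(2)]) (auto simp: f dist_real_def)
  then have "(arclength_param \<kappa> p S has_vector_derivative
      ((- cs \<kappa> L / sn \<kappa> L) *\<^sub>R p + (1 / sn \<kappa> L) *\<^sub>R q)) (at_right 0)"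
    by (rule has_vector_derivative_within_subset) auto
  then have "initial_velocity \<kappa> p S = (- cs \<kappa> L / sn \<kappa> L) *\<^sub>R p + (1 / sn \<kappa> L) *\<^sub>R q"
    unfolding initial_velocity_def by (intro vector_derivative_within) auto
  also have "\<dots> = (1 / sn \<kappa> L) *\<^sub>R (q - cs \<kappa> L *\<^sub>R p)"
    by (simp add: scaleR_right_diff_distrib)
  finally show ?thesis .
qed

section \<open>Angles and determinants\<close>

text \<open>
  The flat plane is lifted to height 1, so that for every \<open>\<kappa>\<close> the surface misses the origin and the determinant of three
  points vanishes exactly when they lie on a common geodesic line.
\<close>

definition cone_point :: "real \<Rightarrow> real^3 \<Rightarrow> real^3" where
  "cone_point \<kappa> x = (if \<kappa> = 0 then x + axis 3 1 else x)"

lemma velocity_cone_point: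
  "q - cs \<kappa> L *\<^sub>R p = cone_point \<kappa> q - cs \<kappa> L *\<^sub>R cone_point \<kappa> p"
  by (auto simp: cone_point_def)

lemma velocity_unit_tangent:
  assumes p: "p \<in> model_surface \<kappa>" and q: "q \<in> model_surface \<kappa>"
    and L: "L = model_dist \<kappa> p q" "0 < L" "0 < sn \<kappa> L"
    and v: "v = (1 / sn \<kappa> L) *\<^sub>R (q - cs \<kappa> L *\<^sub>R p)"
  shows "model_form \<kappa> v v = 1" "\<kappa> * model_form \<kappa> p v = 0"
proof -
  have "model_form \<kappa> v v = 1 \<and> \<kappa> * model_form \<kappa> p v = 0"
  proof (cases "\<kappa> = 0")
    case True
    then have "norm v = 1" using L by (simp add: v model_dist_def dist_norm norm_minus_commute)
    then show ?thesis using True by (simp add: model_form_def dot_square_norm)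
  next
    case False
    have self: "\<kappa> * model_form \<kappa> p p = 1" "\<kappa> * model_form \<kappa> q q = 1"
      using model_form_self p q False by blast+
    have pq: "\<kappa> * model_form \<kappa> p q = cs \<kappa> L" using cs_model_dist[OF p q False] L by simp
    define z where "z = q - cs \<kappa> L *\<^sub>R p"
    have "\<kappa> * model_form \<kappa> p z = 0" "\<kappa> * model_form \<kappa> z z = 1 - (cs \<kappa> L)\<^sup>2"
      using self pq unfolding z_def model_form_linear model_form_commute[of \<kappa> q p]
      by algebra+
    moreover from this(2) have "\<kappa> * model_form \<kappa> z z = \<kappa> * (sn \<kappa> L)\<^sup>2"
      using cs_sn_pythagoras[of \<kappa> L] by simp
    then have "model_form \<kappa> z z = (sn \<kappa> L)\<^sup>2" using False by simp
    ultimately show ?thesis using L unfolding v z_def[symmetric]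
      by (simp add: model_form_linear power2_eq_square)
  qed
  then show "model_form \<kappa> v v = 1" "\<kappa> * model_form \<kappa> p v = 0" by auto
qed

text \<open>
  The Gram matrix of three vectors for the form \<open>diag (1, 1, s)\<close> has determinant \<open>s\<close> times the square of the
  determinant of the vectors. A general \<open>s\<close> treats the Euclidean and the Minkowski form at once.
\<close>

lemma Gram_determinant_3: fixes a :: real shows "(s::real) * (a * (e * i - f * h) + b * (f * g - d * i) + c * (d * h - e * g))\<^sup>2 =
 (a*a+b*b+s*(c*c)) * ((d*d+e*e+s*(f*f))*(g*g+h*h+s*(i*i)) - (d*g+e*h+s*(f*i))\<^sup>2)
 - (a*d+b*e+s*(c*f)) * ((a*d+b*e+s*(c*f))*(g*g+h*h+s*(i*i)) - (d*g+e*h+s*(f*i))*(a*g+b*h+s*(c*i)))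
 + (a*g+b*h+s*(c*i)) * ((a*d+b*e+s*(c*f))*(d*g+e*h+s*(f*i)) - (d*d+e*e+s*(f*f))*(a*g+b*h+s*(c*i)))"
  by algebra
lemma det3_Gram:
  "(if \<kappa> < 0 then - 1 else 1) * (det3 x y z)\<^sup>2 =
     model_form \<kappa> x x * (model_form \<kappa> y y * model_form \<kappa> z z - (model_form \<kappa> y z)\<^sup>2)
     - model_form \<kappa> x y * (model_form \<kappa> x y * model_form \<kappa> z z - model_form \<kappa> y z * model_form \<kappa> x z)
     + model_form \<kappa> x z * (model_form \<kappa> x y * model_form \<kappa> y z - model_form \<kappa> y y * model_form \<kappa> x z)"
  unfolding det3_expand model_form_coords
  by (rule Gram_determinant_3)


text \<open>
  For \<open>\<kappa> \<noteq> 0\<close> the Gram matrix of \<open>p, v, w\<close> is a block \<open>1/\<kappa>\<close> next to the Gram matrix of the unit vectors \<open>v\<close> and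
  \<open>w\<close>, because both are tangent at \<open>p\<close>; for \<open>\<kappa> = 0\<close> the determinant is that of the planar vectors \<open>v\<close> and
  \<open>w\<close>. In both cases \<open>v\<close> and \<open>w\<close> differ from \<open>q / sn L\<close> and \<open>r / sn L'\<close> only by multiples of \<open>p\<close>.
\<close>

lemma sine_squared_eq_det3:
  assumes p: "p \<in> model_surface \<kappa>" and q: "q \<in> model_surface \<kappa>" and r: "r \<in> model_surface \<kappa>"
    and L: "L = model_dist \<kappa> p q" "0 < L" "0 < sn \<kappa> L"
    and L': "L' = model_dist \<kappa> p r" "0 < L'" "0 < sn \<kappa> L'"
    and v: "v = (1 / sn \<kappa> L) *\<^sub>R (q - cs \<kappa> L *\<^sub>R p)"
    and w: "w = (1 / sn \<kappa> L') *\<^sub>R (r - cs \<kappa> L' *\<^sub>R p)"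
  shows "1 - (model_form \<kappa> v w)\<^sup>2 = (if \<kappa> = 0 then 1 else \<bar>\<kappa>\<bar>) *
    (det3 (cone_point \<kappa> p) (cone_point \<kappa> q) (cone_point \<kappa> r) / (sn \<kappa> L * sn \<kappa> L'))\<^sup>2"
proof -
  note vv = velocity_unit_tangent[OF p q L v] and ww = velocity_unit_tangent[OF p r L' w]
  have "1 - (model_form \<kappa> v w)\<^sup>2 = (if \<kappa> = 0 then 1 else \<bar>\<kappa>\<bar>) * (det3 (cone_point \<kappa> p) v w)\<^sup>2"
  proof (cases "\<kappa> = 0")
    case True
    then have "p$3 = 0" "q$3 = 0" "r$3 = 0" using p q r by (auto simp: model_surface_def)
    then have "v$3 = 0" "w$3 = 0" by (auto simp: v w)
    moreover from this have "v$1 * v$1 + v$2 * v$2 = 1" "w$1 * w$1 + w$2 * w$2 = 1"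
      using vv(1) ww(1) True by (auto simp: model_form_coords)
    moreover have "det3 (cone_point \<kappa> p) v w = v$1 * w$2 - v$2 * w$1"
      using True \<open>p$3 = 0\<close> \<open>v$3 = 0\<close> \<open>w$3 = 0\<close> by (simp add: cone_point_def det3_expand axis_def)
    moreover have "(v$1 * w$1 + v$2 * w$2)\<^sup>2 + (v$1 * w$2 - v$2 * w$1)\<^sup>2
        = (v$1 * v$1 + v$2 * v$2) * (w$1 * w$1 + w$2 * w$2)"
      by (simp add: power2_eq_square algebra_simps)
    ultimately show ?thesis using True by (simp add: model_form_coords)
  next
    case False
    then have "(if \<kappa> < 0 then - 1 else 1) * (det3 p v w)\<^sup>2 =
        model_form \<kappa> p p * (1 - (model_form \<kappa> v w)\<^sup>2)"
      using det3_Gram[of \<kappa> p v w] vv ww by simp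
    then have "\<kappa> * ((if \<kappa> < 0 then - 1 else 1) * (det3 p v w)\<^sup>2) = 1 - (model_form \<kappa> v w)\<^sup>2"
      using model_form_self[OF p False] by (metis mult.assoc mult_1)
    then show ?thesis using False by (auto simp: cone_point_def abs_if)
  qed
  also have "det3 (cone_point \<kappa> p) v w
      = 1 / sn \<kappa> L * (1 / sn \<kappa> L') * det3 (cone_point \<kappa> p)
          (cone_point \<kappa> q + (- cs \<kappa> L) *\<^sub>R cone_point \<kappa> p)
          (cone_point \<kappa> r + (- cs \<kappa> L') *\<^sub>R cone_point \<kappa> p)"
    unfolding v w velocity_cone_point[of q \<kappa> L p] velocity_cone_point[of r \<kappa> L' p]
    using det3_scaleR[of 1 "cone_point \<kappa> p" "1 / sn \<kappa> L" _ "1 / sn \<kappa> L'"]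
    by (simp only: scaleR_one mult_1 scaleR_minus_left diff_conv_add_uminus)
  finally show ?thesis unfolding det3_add_multiples by simp
qed

lemma geodesic_angle_bounds:
  assumes S: "geodesic_segment \<kappa> p q S" and S': "geodesic_segment \<kappa> p r S'"
    and L: "L = model_dist \<kappa> p q" "0 < L" "0 < sn \<kappa> L"
    and L': "L' = model_dist \<kappa> p r" "0 < L'" "0 < sn \<kappa> L'"
    and \<sigma>: "0 < \<sigma>" "\<sigma> \<le> 1"
    and ge: "\<sigma> \<le> (if \<kappa> = 0 then 1 else \<bar>\<kappa>\<bar>) *
      (det3 (cone_point \<kappa> p) (cone_point \<kappa> q) (cone_point \<kappa> r) / (sn \<kappa> L * sn \<kappa> L'))\<^sup>2"
  shows "arccos (sqrt (1 - \<sigma>)) \<le> geodesic_angle \<kappa> p S S'"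
    "geodesic_angle \<kappa> p S S' \<le> pi - arccos (sqrt (1 - \<sigma>))"
proof -
  have pqr: "p \<in> model_surface \<kappa>" "q \<in> model_surface \<kappa>" "r \<in> model_surface \<kappa>"
    using S S' by (auto simp: geodesic_segment_def)
  define g where "g = model_form \<kappa> (initial_velocity \<kappa> p S) (initial_velocity \<kappa> p S')"
  have "\<sigma> \<le> 1 - g\<^sup>2"
    using ge sine_squared_eq_det3[OF pqr L L' refl refl]
    unfolding g_def initial_velocity_eq[OF S L] initial_velocity_eq[OF S' L'] by simp
  then have "\<bar>g\<bar> \<le> sqrt (1 - \<sigma>)" by (intro real_le_rsqrt) simp
  moreover have "sqrt (1 - \<sigma>) \<le> 1" using \<sigma> by simp
  ultimately have g: "- sqrt (1 - \<sigma>) \<le> g" "g \<le> sqrt (1 - \<sigma>)" "- 1 \<le> g" "g \<le> 1"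
    by linarith+
  have "arccos (sqrt (1 - \<sigma>)) \<le> arccos g" using g \<sigma> by (intro arccos_le_arccos) auto
  moreover have "arccos g \<le> arccos (- sqrt (1 - \<sigma>))" using g \<sigma> by (intro arccos_le_arccos) auto
  moreover have "arccos (- sqrt (1 - \<sigma>)) = pi - arccos (sqrt (1 - \<sigma>))"
    using \<sigma> real_sqrt_ge_zero[of "1 - \<sigma>"] \<open>sqrt (1 - \<sigma>) \<le> 1\<close> by (intro arccos_minus) linarith+
  ultimately show "arccos (sqrt (1 - \<sigma>)) \<le> geodesic_angle \<kappa> p S S'"
    "geodesic_angle \<kappa> p S S' \<le> pi - arccos (sqrt (1 - \<sigma>))"
    by (simp_all add: geodesic_angle_def g_def)
qed

lemma geodesic_segment_ends:
  assumes "geodesic_segment \<kappa> p q S"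
  shows "p \<in> S" "q \<in> S"
proof -
  let ?L = "model_dist \<kappa> p q"
  obtain c where c: "c 0 = p" "c ?L = q" "S = c ` {0..?L}"
    and "p \<in> model_surface \<kappa>" "q \<in> model_surface \<kappa>"
    using assms by (auto simp: geodesic_segment_def geodesic_path_def)
  then have "0 \<in> {0..?L}" "?L \<in> {0..?L}" using model_dist_nonneg by auto
  then show "p \<in> S" "q \<in> S" using c by (metis imageI)+
qed

section \<open>Central projection to an affine chart\<close>

text \<open>
  For \<open>\<kappa> \<le> 0\<close> projecting along the axis covers the whole surface, whereas for \<open>\<kappa> > 0\<close> the direction \<open>u\<close> stays free, to be the
  pole of an open hemisphere that contains the given triangle.
\<close>

definition adapted :: "real \<Rightarrow> real^3 \<Rightarrow> bool" where
  "adapted \<kappa> u \<longleftrightarrow> (\<kappa> \<le> 0 \<longrightarrow> u = axis 3 1)"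

definition weight :: "real \<Rightarrow> real^3 \<Rightarrow> real^3 \<Rightarrow> real" where
  "weight \<kappa> u x = u \<bullet> cone_point \<kappa> x"

definition chart :: "real \<Rightarrow> real^3 \<Rightarrow> real^3 \<Rightarrow> real^3" where
  "chart \<kappa> u x = (1 / weight \<kappa> u x) *\<^sub>R cone_point \<kappa> x"

lemma cone_point_eq_chart: "0 < weight \<kappa> u x \<Longrightarrow> cone_point \<kappa> x = weight \<kappa> u x *\<^sub>R chart \<kappa> u x"
  by (simp add: chart_def)

lemma inner_chart: "0 < weight \<kappa> u x \<Longrightarrow> u \<bullet> chart \<kappa> u x = 1"
  by (simp add: chart_def) (simp add: weight_def)

lemma weight_flat:
  assumes "adapted 0 u" "x \<in> model_surface 0"
  shows "weight 0 u x = 1"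
  using assms by (simp add: adapted_def weight_def cone_point_def model_surface_def inner_axis')

lemma weight_pos_nonpos:
  assumes "adapted \<kappa> u" "\<kappa> \<le> 0" "x \<in> model_surface \<kappa>"
  shows "0 < weight \<kappa> u x"
proof (cases "\<kappa> = 0")
  case True
  then show ?thesis using weight_flat assms by simp
next
  case False
  then show ?thesis using assms
    by (simp add: adapted_def weight_def cone_point_def model_surface_def inner_axis')
qed

text \<open>
  Together with \<open>weight_flat\<close> this shows that the weight is a smooth function of the chart point. It is
  the source of its boundedness and Lipschitz continuity on compact sets.
\<close>

lemma weight_form_chart:
  assumes "x \<in> model_surface \<kappa>" "\<kappa> \<noteq> 0" "0 < weight \<kappa> u x"
  shows "(weight \<kappa> u x)\<^sup>2 * (\<kappa> * model_form \<kappa> (chart \<kappa> u x) (chart \<kappa> u x)) = 1"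
proof -
  have "x = weight \<kappa> u x *\<^sub>R chart \<kappa> u x"
    using cone_point_eq_chart[OF assms(3)] assms(2) by (simp add: cone_point_def)
  then have "\<kappa> * model_form \<kappa> (weight \<kappa> u x *\<^sub>R chart \<kappa> u x) (weight \<kappa> u x *\<^sub>R chart \<kappa> u x) = 1"
    using model_form_self[OF assms(1,2)] by metis
  then show ?thesis by (simp add: model_form_linear power2_eq_square mult_ac)
qed

lemma chart_inj:
  assumes "adapted \<kappa> u" and x: "x \<in> model_surface \<kappa>" "0 < weight \<kappa> u x"
    and y: "y \<in> model_surface \<kappa>" "0 < weight \<kappa> u y" and eq: "chart \<kappa> u x = chart \<kappa> u y"
  shows "x = y"
proof -
  have "weight \<kappa> u x = weight \<kappa> u y"
  proof (cases "\<kappa> = 0")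
    case True
    then show ?thesis using weight_flat assms by metis
  next
    case False
    let ?g = "\<kappa> * model_form \<kappa> (chart \<kappa> u x) (chart \<kappa> u x)"
    have "(weight \<kappa> u x)\<^sup>2 * ?g = 1" "(weight \<kappa> u y)\<^sup>2 * ?g = 1"
      using weight_form_chart[OF x(1) False x(2)] weight_form_chart[OF y(1) False y(2)] eq by auto
    then have "(weight \<kappa> u x)\<^sup>2 = (weight \<kappa> u y)\<^sup>2"
      by (metis mult_cancel_right mult_zero_right zero_neq_one)
    then show ?thesis using x(2) y(2) by (simp add: power2_eq_iff_nonneg)
  qed
  then have "cone_point \<kappa> x = cone_point \<kappa> y"
    using eq cone_point_eq_chart x(2) y(2) by metis
  then show ?thesis by (auto simp: cone_point_def split: if_splits)
qed

lemma model_dist_pos_chart: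
  assumes "x \<in> model_surface \<kappa>" "y \<in> model_surface \<kappa>" "0 < weight \<kappa> u x" "0 < weight \<kappa> u y"
    "x \<noteq> y"
  shows "0 < model_dist \<kappa> x y" "0 < sn \<kappa> (model_dist \<kappa> x y)"
proof -
  have "\<kappa> > 0 \<Longrightarrow> 0 < u \<bullet> x \<and> 0 < u \<bullet> y"
    using assms(3,4) by (simp add: weight_def cone_point_def)
  then show "0 < model_dist \<kappa> x y" "0 < sn \<kappa> (model_dist \<kappa> x y)"
    using model_dist_pos[OF assms(1,2,5)] by blast+
qed

text \<open>
  For \<open>\<kappa> \<noteq> 0\<close> the square of \<open>sn\<close> of the distance is \<open>\<kappa>\<close> times the Gram determinant of \<open>x\<close> and \<open>y\<close>. Extracting
  the weights and subtracting one chart point from the other, which leaves the determinant unchanged,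
  makes it quadratic in the difference of the chart points.
\<close>

lemma sn_dist_le_chart_dist:
  assumes x: "x \<in> model_surface \<kappa>" and y: "y \<in> model_surface \<kappa>"
    and w: "0 < weight \<kappa> u x" "0 < weight \<kappa> u y" "weight \<kappa> u x \<le> W" "weight \<kappa> u y \<le> W"
    and r: "norm (chart \<kappa> u x) \<le> r" and "adapted \<kappa> u"
  shows "sn \<kappa> (model_dist \<kappa> x y)
    \<le> sqrt (2 * \<bar>\<kappa>\<bar> * W ^ 4 * r\<^sup>2 + 1) * dist (chart \<kappa> u x) (chart \<kappa> u y)"
proof -
  define x' y' where "x' = chart \<kappa> u x" and "y' = chart \<kappa> u y"
  define p q where "p = weight \<kappa> u x" and "q = weight \<kappa> u y"
  have sq: "(sn \<kappa> (model_dist \<kappa> x y))\<^sup>2 \<le> (2 * \<bar>\<kappa>\<bar> * W ^ 4 * r\<^sup>2 + 1) * (dist x' y')\<^sup>2"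
  proof (cases "\<kappa> = 0")
    case True
    have "weight \<kappa> u x = 1" "weight \<kappa> u y = 1" using weight_flat assms True by auto
    then have "dist x' y' = dist x y" using True
      by (simp add: x'_def y'_def chart_def cone_point_def dist_norm)
    then show ?thesis using True by (simp add: model_dist_def)
  next
    case False
    have xy: "x = p *\<^sub>R x'" "y = q *\<^sub>R y'"
      using cone_point_eq_chart[OF w(1)] cone_point_eq_chart[OF w(2)] False
      by (auto simp: cone_point_def x'_def y'_def p_def q_def)
    let ?f = "model_form \<kappa>"
    have "\<kappa> * (sn \<kappa> (model_dist \<kappa> x y))\<^sup>2 = 1 - (\<kappa> * ?f x y)\<^sup>2"
      using cs_sn_pythagoras[of \<kappa> "model_dist \<kappa> x y"] cs_model_dist[OF x y False] by simp
    also have "\<dots> = (\<kappa> * ?f x x) * (\<kappa> * ?f y y) - (\<kappa> * ?f x y)\<^sup>2"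
      using model_form_self x y False by simp
    also have "\<dots> = \<kappa> * (\<kappa> * (?f x x * ?f y y - (?f x y)\<^sup>2))"
      by (simp add: power2_eq_square algebra_simps)
    finally have "(sn \<kappa> (model_dist \<kappa> x y))\<^sup>2 = \<kappa> * (?f x x * ?f y y - (?f x y)\<^sup>2)"
      using False by simp
    also have "?f x x * ?f y y - (?f x y)\<^sup>2 = (p * q)\<^sup>2 * (?f x' x' * ?f y' y' - (?f x' y')\<^sup>2)"
      unfolding xy by (simp add: model_form_linear power2_eq_square algebra_simps)
    also have "?f x' x' * ?f y' y' - (?f x' y')\<^sup>2
        = ?f x' x' * ?f (y' - x') (y' - x') - (?f x' (y' - x'))\<^sup>2"
      by (simp add: model_form_linear model_form_commute[of \<kappa> y' x'] power2_eq_square algebra_simps)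
    also have "\<kappa> * ((p * q)\<^sup>2 * (?f x' x' * ?f (y' - x') (y' - x') - (?f x' (y' - x'))\<^sup>2))
        \<le> \<bar>\<kappa>\<bar> * ((p * q)\<^sup>2 * (2 * (norm x')\<^sup>2 * (dist x' y')\<^sup>2))"
    proof -
      let ?d = "dist x' y'"
      have d: "norm (y' - x') = ?d" by (simp add: dist_norm norm_minus_commute)
      have 1: "\<bar>?f x' x'\<bar> \<le> (norm x')\<^sup>2" "\<bar>?f (y' - x') (y' - x')\<bar> \<le> ?d\<^sup>2"
        "\<bar>?f x' (y' - x')\<bar> \<le> norm x' * ?d"
        using abs_model_form_le[of \<kappa> x' x'] abs_model_form_le[of \<kappa> "y' - x'" "y' - x'"]
          abs_model_form_le[of \<kappa> x' "y' - x'"] by (simp_all add: d power2_eq_square)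
      have "\<bar>?f x' x' * ?f (y' - x') (y' - x')\<bar> \<le> (norm x')\<^sup>2 * ?d\<^sup>2"
        unfolding abs_mult using 1 by (intro mult_mono) auto
      moreover have "(?f x' (y' - x'))\<^sup>2 \<le> (norm x' * ?d)\<^sup>2"
        using 1(3) by (metis abs_ge_zero power2_abs power_mono)
      moreover have "(norm x' * ?d)\<^sup>2 = (norm x')\<^sup>2 * ?d\<^sup>2" by (simp add: power_mult_distrib)
      moreover have "0 \<le> (?f x' (y' - x'))\<^sup>2" by simp
      ultimately have G: "\<bar>?f x' x' * ?f (y' - x') (y' - x') - (?f x' (y' - x'))\<^sup>2\<bar>
          \<le> 2 * (norm x')\<^sup>2 * ?d\<^sup>2" (is "\<bar>?G\<bar> \<le> _") by linarith
      have "\<kappa> * ((p * q)\<^sup>2 * ?G) \<le> \<bar>\<kappa> * ((p * q)\<^sup>2 * ?G)\<bar>" by (rule abs_ge_self)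
      also have "\<dots> = \<bar>\<kappa>\<bar> * ((p * q)\<^sup>2 * \<bar>?G\<bar>)" by (simp only: abs_mult abs_power2)
      also have "\<dots> \<le> \<bar>\<kappa>\<bar> * ((p * q)\<^sup>2 * (2 * (norm x')\<^sup>2 * ?d\<^sup>2))"
        by (rule mult_left_mono[OF mult_left_mono[OF G]]) auto
      finally show ?thesis .
    qed
    also have "\<dots> \<le> \<bar>\<kappa>\<bar> * ((W * W)\<^sup>2 * (2 * r\<^sup>2 * (dist x' y')\<^sup>2))"
      using w r by (intro mult_left_mono mult_mono power_mono) (auto simp: p_def q_def x'_def)
    also have "\<dots> = 2 * \<bar>\<kappa>\<bar> * W ^ 4 * r\<^sup>2 * (dist x' y')\<^sup>2"
      by (simp add: power2_eq_square eval_nat_numeral)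
    also have "\<dots> \<le> (2 * \<bar>\<kappa>\<bar> * W ^ 4 * r\<^sup>2 + 1) * (dist x' y')\<^sup>2"
      by (simp add: algebra_simps)
    finally show ?thesis .
  qed
  have "sn \<kappa> (model_dist \<kappa> x y) \<le> sqrt ((2 * \<bar>\<kappa>\<bar> * W ^ 4 * r\<^sup>2 + 1) * (dist x' y')\<^sup>2)"
    using sq by (rule real_le_rsqrt)
  then show ?thesis by (simp add: real_sqrt_mult x'_def y'_def)
qed

lemma chart_combination:
  assumes x: "cone_point \<kappa> x = \<alpha> *\<^sub>R cone_point \<kappa> p + \<beta> *\<^sub>R cone_point \<kappa> q"
    and w: "0 < weight \<kappa> u p" "0 < weight \<kappa> u q" and pos: "0 \<le> \<alpha>" "0 \<le> \<beta>" "0 < \<alpha> + \<beta>"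
  defines "\<tau> \<equiv> \<beta> * weight \<kappa> u q / (\<alpha> * weight \<kappa> u p + \<beta> * weight \<kappa> u q)"
  shows "0 < weight \<kappa> u x" "chart \<kappa> u x = (1 - \<tau>) *\<^sub>R chart \<kappa> u p + \<tau> *\<^sub>R chart \<kappa> u q"
proof -
  let ?s = "\<alpha> * weight \<kappa> u p + \<beta> * weight \<kappa> u q"
  have s: "weight \<kappa> u x = ?s" by (simp add: weight_def x inner_add_right)
  show pos': "0 < weight \<kappa> u x" unfolding s using w pos
    by (metis add_nonneg_pos add_pos_nonneg less_eq_real_def mult_nonneg_nonneg mult_pos_pos
        add.right_neutral add_0_left)
  have t: "1 - \<tau> = \<alpha> * weight \<kappa> u p / ?s" using pos' s by (simp add: \<tau>_def field_simps)
  have "(1 - \<tau>) *\<^sub>R chart \<kappa> u p = (\<alpha> / ?s) *\<^sub>R cone_point \<kappa> p"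
    unfolding t using w by (simp add: chart_def)
  moreover have "\<tau> *\<^sub>R chart \<kappa> u q = (\<beta> / ?s) *\<^sub>R cone_point \<kappa> q"
    using w by (simp add: \<tau>_def chart_def)
  moreover have "chart \<kappa> u x = (\<alpha> / ?s) *\<^sub>R cone_point \<kappa> p + (\<beta> / ?s) *\<^sub>R cone_point \<kappa> q"
    by (simp add: chart_def s x scaleR_right_distrib)
  ultimately show "chart \<kappa> u x = (1 - \<tau>) *\<^sub>R chart \<kappa> u p + \<tau> *\<^sub>R chart \<kappa> u q"
    by (simp only:)
qed

lemma cone_point_geodesic:
  assumes "geodesic_path \<kappa> p q c" "p \<in> model_surface \<kappa>" "q \<in> model_surface \<kappa>"
    and L: "L = model_dist \<kappa> p q" "0 < L" "0 < sn \<kappa> L" and t: "0 \<le> t" "t \<le> L"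
  shows "cone_point \<kappa> (c t) =
    (sn \<kappa> (L - t) / sn \<kappa> L) *\<^sub>R cone_point \<kappa> p + (sn \<kappa> t / sn \<kappa> L) *\<^sub>R cone_point \<kappa> q"
proof (cases "\<kappa> = 0")
  case True
  have "(L - t) / L + t / L = 1" using L by (simp add: field_simps)
  then have "((L - t) / L) *\<^sub>R axis 3 1 + (t / L) *\<^sub>R axis 3 1 = (axis 3 1 :: real^3)"
    by (simp add: scaleR_left_distrib[symmetric])
  then show ?thesis using geodesic_path_formula[OF assms] True
    by (simp add: cone_point_def scaleR_right_distrib add_ac)
next
  case False
  then show ?thesis using geodesic_path_formula[OF assms] by (simp add: cone_point_def)
qed

lemma sn_half_dist_pos:
  assumes "p \<in> model_surface \<kappa>" "q \<in> model_surface \<kappa>" "0 < model_dist \<kappa> p q"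
  shows "0 < sn \<kappa> (model_dist \<kappa> p q / 2)"
proof (rule sn_pos)
  assume "\<kappa> > 0"
  then have "sqrt \<kappa> * model_dist \<kappa> p q \<le> pi" using model_dist_le_pi assms by blast
  moreover have "sqrt \<kappa> * (model_dist \<kappa> p q / 2) = sqrt \<kappa> * model_dist \<kappa> p q / 2" by simp
  ultimately show "sqrt \<kappa> * (model_dist \<kappa> p q / 2) < pi" using pi_gt_zero by linarith
qed (use assms in simp)

lemma chart_segment_midpoint:
  assumes S: "geodesic_segment \<kappa> p q S" and w: "0 < weight \<kappa> u p" "0 < weight \<kappa> u q"
    and "p \<noteq> q"
  defines "m \<equiv> segment_midpoint \<kappa> p q S"
    and "\<tau> \<equiv> weight \<kappa> u q / (weight \<kappa> u p + weight \<kappa> u q)"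
  shows "0 < weight \<kappa> u m" "chart \<kappa> u m = (1 - \<tau>) *\<^sub>R chart \<kappa> u p + \<tau> *\<^sub>R chart \<kappa> u q"
proof -
  let ?L = "model_dist \<kappa> p q"
  obtain c where c: "geodesic_path \<kappa> p q c" "S = c ` {0..?L}"
    and pq: "p \<in> model_surface \<kappa>" "q \<in> model_surface \<kappa>"
    using S by (auto simp: geodesic_segment_def)
  note L = model_dist_pos_chart[OF pq w \<open>p \<noteq> q\<close>]
  define a where "a = sn \<kappa> (?L / 2) / sn \<kappa> ?L"
  have a: "0 < a" using sn_half_dist_pos[OF pq L(1)] L(2) by (simp add: a_def)
  have "m = c (?L / 2)" using segment_midpoint_path[OF c(1)] L(1) c(2) by (simp add: m_def)
  then have m: "cone_point \<kappa> m = a *\<^sub>R cone_point \<kappa> p + a *\<^sub>R cone_point \<kappa> q"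
    using cone_point_geodesic[OF c(1) pq refl L, of "?L / 2"] L(1) by (simp add: a_def)
  have "a * weight \<kappa> u q / (a * weight \<kappa> u p + a * weight \<kappa> u q) = \<tau>"
    using a by (simp add: \<tau>_def distrib_left[symmetric])
  then show "0 < weight \<kappa> u m" "chart \<kappa> u m = (1 - \<tau>) *\<^sub>R chart \<kappa> u p + \<tau> *\<^sub>R chart \<kappa> u q"
    using chart_combination[OF m w] a by auto
qed

text \<open>
  The chart image of a geodesic from \<open>p\<close> to \<open>q\<close> moves continuously within the straight segment from one end to the
  other, hence passes through every point of it by the intermediate value theorem.
\<close>

lemma chart_between_imp_in_segment:
  assumes S: "geodesic_segment \<kappa> p q S" and w: "0 < weight \<kappa> u p" "0 < weight \<kappa> u q"
    and "adapted \<kappa> u" and x: "x \<in> model_surface \<kappa>" "0 < weight \<kappa> u x"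
    and between: "chart \<kappa> u x \<in> closed_segment (chart \<kappa> u p) (chart \<kappa> u q)"
  shows "x \<in> S"
proof -
  let ?L = "model_dist \<kappa> p q"
  obtain c where c: "geodesic_path \<kappa> p q c" "S = c ` {0..?L}"
    and pq: "p \<in> model_surface \<kappa>" "q \<in> model_surface \<kappa>"
    using S by (auto simp: geodesic_segment_def)
  show ?thesis
  proof (cases "p = q")
    case True
    then have "x = p" using chart_inj[OF \<open>adapted \<kappa> u\<close> x pq(1) w(1)] between by simp
    then show ?thesis using geodesic_segment_ends(1)[OF S] by simp
  next
    case False
    note L = model_dist_pos_chart[OF pq w False]
    define s where "s t = sn \<kappa> (?L - t) / sn \<kappa> ?L * weight \<kappa> u p + sn \<kappa> t / sn \<kappa> ?L * weight \<kappa> u q" for t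
    define \<tau> where "\<tau> t = sn \<kappa> t / sn \<kappa> ?L * weight \<kappa> u q / s t" for t
    have on: "0 < weight \<kappa> u (c t)" "0 < s t"
      "chart \<kappa> u (c t) = (1 - \<tau> t) *\<^sub>R chart \<kappa> u p + \<tau> t *\<^sub>R chart \<kappa> u q"
      if t: "0 \<le> t" "t \<le> ?L" for t
    proof -
      note ct = cone_point_geodesic[OF c(1) pq refl L t]
      have nn: "0 \<le> sn \<kappa> (?L - t) / sn \<kappa> ?L" "0 \<le> sn \<kappa> t / sn \<kappa> ?L"
        using sn_nonneg_upto_dist[OF pq] t L by auto
      have "0 < sn \<kappa> (?L - t) / sn \<kappa> ?L + sn \<kappa> t / sn \<kappa> ?L"
      proof (rule ccontr)
        assume "\<not> ?thesis"
        then have "sn \<kappa> (?L - t) / sn \<kappa> ?L = 0" "sn \<kappa> t / sn \<kappa> ?L = 0" using nn by linarith+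
        then have "sn \<kappa> ?L * cs \<kappa> t = 0" "sn \<kappa> t = 0" using L by (auto simp: sn_diff)
        then show False using cs_sn_pythagoras[of \<kappa> t] L by auto
      qed
      note cc = chart_combination[OF ct w nn this]
      show "0 < weight \<kappa> u (c t)" by (rule cc)
      moreover have "weight \<kappa> u (c t) = s t" unfolding weight_def ct s_def by (simp add: inner_add_right)
      ultimately show "0 < s t" by simp
      show "chart \<kappa> u (c t) = (1 - \<tau> t) *\<^sub>R chart \<kappa> u p + \<tau> t *\<^sub>R chart \<kappa> u q"
        using cc(2) by (simp add: \<tau>_def s_def)
    qed
    obtain v where v: "0 \<le> v" "v \<le> 1" "chart \<kappa> u x = (1 - v) *\<^sub>R chart \<kappa> u p + v *\<^sub>R chart \<kappa> u q"
      using between by (auto simp: in_segment)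
    have "continuous_on {0..?L} \<tau>" unfolding \<tau>_def
      using on(2) L by (force simp: s_def intro!: continuous_intros)
    moreover have "\<tau> 0 = 0" "\<tau> ?L = 1" using L w by (simp_all add: \<tau>_def s_def)
    ultimately obtain t where t: "0 \<le> t" "t \<le> ?L" "\<tau> t = v"
      using IVT'[of \<tau> 0 v ?L] v L by auto
    have "x = c t"
      using chart_inj[OF \<open>adapted \<kappa> u\<close> x _ on(1)] geodesic_path_dist(3)[OF c(1)] on(3) t v by auto
    then show ?thesis using t c(2) by simp
  qed
qed

text \<open>
  The normal \<open>n\<close> of the two difference vectors is parallel to \<open>u\<close>, both differences being orthogonal to
  \<open>u\<close>. The vanishing determinant makes it orthogonal to \<open>x\<close>, and \<open>u \<bullet> x = 1\<close> then leaves only \<open>n = 0\<close>.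
\<close>

lemma collinear_of_det3_0:
  assumes "det3 x y z = 0" "u \<bullet> x = 1" "u \<bullet> y = 1" "u \<bullet> z = 1"
  shows "collinear {x, y, z}"
proof -
  define n where "n = cross3 (x - y) (z - y)"
  have "x \<bullet> n = 0" using assms(1)
    by (simp add: n_def det3_def cross3_def inner_real3 algebra_simps)
  have "cross3 u n = 0"
    using assms(2-4) by (simp add: n_def Lagrange inner_diff_right)
  then obtain r where "n = r *\<^sub>R u"
    using assms(2) unfolding cross_eq_0 collinear_lemma
    by (metis inner_zero_left scaleR_zero_left zero_neq_one)
  with \<open>x \<bullet> n = 0\<close> assms(2) have "n = 0" by (simp add: inner_commute)
  then have "collinear {0, x - y, z - y}" unfolding n_def cross_eq_0 .
  then show ?thesis by (rule collinear_3[THEN iffD2, rotated]) (simp add: NO_MATCH_def)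
qed

text \<open>
  Of three collinear chart points one lies between the other two, and then the corresponding vertex lies on the edge joining
  the other two.
\<close>

lemma chart_det3_nonzero:
  assumes T: "geodesic_triangle \<kappa> (Tri A B C a b c)" "nondegenerate \<kappa> (Tri A B C a b c)"
    and w: "0 < weight \<kappa> u A" "0 < weight \<kappa> u B" "0 < weight \<kappa> u C" and u: "adapted \<kappa> u"
  shows "det3 (chart \<kappa> u A) (chart \<kappa> u B) (chart \<kappa> u C) \<noteq> 0"
proof
  have seg: "geodesic_segment \<kappa> B C a" "geodesic_segment \<kappa> C A b" "geodesic_segment \<kappa> A B c"
    using T(1) by auto
  have surf: "A \<in> model_surface \<kappa>" "B \<in> model_surface \<kappa>" "C \<in> model_surface \<kappa>"
    using seg by (auto simp: geodesic_segment_def)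
  assume "det3 (chart \<kappa> u A) (chart \<kappa> u B) (chart \<kappa> u C) = 0"
  then have "collinear {chart \<kappa> u A, chart \<kappa> u B, chart \<kappa> u C}"
    using inner_chart w by (intro collinear_of_det3_0[of _ _ _ u]) auto
  then consider "chart \<kappa> u A \<in> closed_segment (chart \<kappa> u B) (chart \<kappa> u C)"
    | "chart \<kappa> u B \<in> closed_segment (chart \<kappa> u C) (chart \<kappa> u A)"
    | "chart \<kappa> u C \<in> closed_segment (chart \<kappa> u A) (chart \<kappa> u B)"
    unfolding collinear_between_cases between_mem_segment by blast
  then have "A \<in> a \<or> B \<in> b \<or> C \<in> c"
    using chart_between_imp_in_segment[OF seg(1) w(2,3) u surf(1) w(1)]
      chart_between_imp_in_segment[OF seg(2) w(3,1) u surf(2) w(2)]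
      chart_between_imp_in_segment[OF seg(3) w(1,2) u surf(3) w(3)] by cases blast+
  then have "{A, B, C} \<subseteq> a \<or> {A, B, C} \<subseteq> b \<or> {A, B, C} \<subseteq> c"
    using geodesic_segment_ends[OF seg(1)] geodesic_segment_ends[OF seg(2)]
      geodesic_segment_ends[OF seg(3)] by blast
  then have "\<exists>p q S. geodesic_segment \<kappa> p q S \<and> {A, B, C} \<subseteq> S" using seg by blast
  then show False using T(2) by (simp add: nondegenerate_def)
qed

section \<open>Subdivision in a compact part of a chart\<close>

text \<open>
  The setting in which the subdivision takes place once \<open>K\<close> has been chosen: \<open>K\<close> is the part of the chart that contains
  all vertices, and the weight is pinched and Lipschitz there.
\<close>

locale bounded_chart =
  fixes \<kappa> :: real and u :: "real^3" and K :: "(real^3) set" and w\<^sub>0 W \<Lambda> r :: real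
  assumes adapted: "adapted \<kappa> u"
    and convex_K: "convex K"
    and w\<^sub>0: "0 < w\<^sub>0" "w\<^sub>0 \<le> W" and \<Lambda>: "0 \<le> \<Lambda>"
    and weight_bounds: "\<lbrakk>X \<in> model_surface \<kappa>; 0 < weight \<kappa> u X; chart \<kappa> u X \<in> K\<rbrakk>
      \<Longrightarrow> w\<^sub>0 \<le> weight \<kappa> u X \<and> weight \<kappa> u X \<le> W"
    and norm_chart: "x \<in> K \<Longrightarrow> norm x \<le> r"
    and weight_Lipschitz: "\<lbrakk>X \<in> model_surface \<kappa>; 0 < weight \<kappa> u X; chart \<kappa> u X \<in> K;
        Y \<in> model_surface \<kappa>; 0 < weight \<kappa> u Y; chart \<kappa> u Y \<in> K\<rbrakk>
      \<Longrightarrow> \<bar>weight \<kappa> u X - weight \<kappa> u Y\<bar> \<le> \<Lambda> * dist (chart \<kappa> u X) (chart \<kappa> u Y)"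
begin

definition inside :: "real^3 \<Rightarrow> bool" where
  "inside X \<longleftrightarrow> X \<in> model_surface \<kappa> \<and> 0 < weight \<kappa> u X \<and> chart \<kappa> u X \<in> K"

text \<open>
  With these constants chart midpoints divide edges in ratios within \<open>[margin, 1 - margin]\<close>, at distance at most \<open>skew\<close>
  times the length of the edge from 1/2. The value of \<open>penalty\<close> is the one demanded by \<open>fat_shrink\<close>, and
  \<open>sn_factor\<close> the constant from \<open>sn_dist_le_chart_dist\<close>.
\<close>

definition margin :: real where "margin = w\<^sub>0 / (2 * W)"
definition skew :: real where "skew = \<Lambda> / (4 * w\<^sub>0)"
definition penalty :: real where "penalty = 5 * skew / margin\<^sup>2"
definition sn_factor :: real where "sn_factor = sqrt (2 * \<bar>\<kappa>\<bar> * W ^ 4 * r\<^sup>2 + 1)"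

lemma margin_pos: "0 < margin" and skew_nonneg: "0 \<le> skew" and sn_factor_pos: "0 < sn_factor"
  using w\<^sub>0 \<Lambda> by (auto simp: margin_def skew_def sn_factor_def add_nonneg_pos)

lemma midpoint_ratio:
  assumes "inside p" "inside q"
  defines "\<tau> \<equiv> weight \<kappa> u q / (weight \<kappa> u p + weight \<kappa> u q)"
  shows "\<bar>\<tau> - 1/2\<bar> \<le> min (skew * dist (chart \<kappa> u p) (chart \<kappa> u q)) (1/2 - margin)"
proof -
  let ?p = "weight \<kappa> u p" and ?q = "weight \<kappa> u q" and ?d = "dist (chart \<kappa> u p) (chart \<kappa> u q)"
  have b: "w\<^sub>0 \<le> ?p" "?p \<le> W" "w\<^sub>0 \<le> ?q" "?q \<le> W" and l: "\<bar>?p - ?q\<bar> \<le> \<Lambda> * ?d"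
    using weight_bounds weight_Lipschitz assms by (auto simp: inside_def)
  have s: "0 < ?p + ?q" using b w\<^sub>0 by linarith
  have "\<bar>\<tau> - 1/2\<bar> = \<bar>?p - ?q\<bar> / (2 * (?p + ?q))"
  proof -
    have "\<tau> - 1/2 = (?q - ?p) / (2 * (?p + ?q))" using s by (simp add: \<tau>_def field_simps)
    then show ?thesis using s by (simp add: abs_minus_commute)
  qed
  also have "\<dots> \<le> (\<Lambda> * ?d) / (4 * w\<^sub>0)" using l b w\<^sub>0 by (intro frac_le) auto
  finally have 1: "\<bar>\<tau> - 1/2\<bar> \<le> skew * ?d" by (simp add: skew_def)
  have ge: "margin \<le> v / (v + v')" if "w\<^sub>0 \<le> v" "w\<^sub>0 \<le> v'" "v \<le> W" "v' \<le> W" for v v'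
    unfolding margin_def using that w\<^sub>0 by (intro frac_le) auto
  have "1 - \<tau> = ?p / (?p + ?q)" using s by (simp add: \<tau>_def field_simps)
  then have "margin \<le> \<tau>" "margin \<le> 1 - \<tau>" using ge[of ?q ?p] ge[of ?p ?q] b by (simp_all add: \<tau>_def add.commute)
  then have "\<bar>\<tau> - 1/2\<bar> \<le> 1/2 - margin" by (simp add: abs_le_iff)
  with 1 show ?thesis by simp
qed

lemma inside_midpoint:
  assumes S: "geodesic_segment \<kappa> p q S" and in_pq: "inside p" "inside q" "p \<noteq> q"
  obtains \<tau> where "inside (segment_midpoint \<kappa> p q S)"
    "chart \<kappa> u (segment_midpoint \<kappa> p q S) = (1 - \<tau>) *\<^sub>R chart \<kappa> u p + \<tau> *\<^sub>R chart \<kappa> u q"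
    "\<bar>\<tau> - 1/2\<bar> \<le> min (skew * dist (chart \<kappa> u p) (chart \<kappa> u q)) (1/2 - margin)"
proof
  let ?\<tau> = "weight \<kappa> u q / (weight \<kappa> u p + weight \<kappa> u q)" and ?m = "segment_midpoint \<kappa> p q S"
  have w: "0 < weight \<kappa> u p" "0 < weight \<kappa> u q" using in_pq by (auto simp: inside_def)
  note m = chart_segment_midpoint[OF S w \<open>p \<noteq> q\<close>]
  show "chart \<kappa> u ?m = (1 - ?\<tau>) *\<^sub>R chart \<kappa> u p + ?\<tau> *\<^sub>R chart \<kappa> u q" by (rule m(2))
  moreover have "0 \<le> ?\<tau>" "?\<tau> \<le> 1" using w by auto
  ultimately have "chart \<kappa> u ?m \<in> K"
    using in_pq convexD_alt[OF convex_K] by (auto simp: inside_def)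
  moreover have "?m \<in> model_surface \<kappa>"
    using geodesic_segment_half[OF S] by (auto simp: geodesic_segment_def)
  ultimately show "inside ?m" using m(1) by (simp add: inside_def)
  show "\<bar>?\<tau> - 1/2\<bar> \<le> min (skew * dist (chart \<kappa> u p) (chart \<kappa> u q)) (1/2 - margin)"
    using midpoint_ratio in_pq by blast
qed

text \<open>
  The invariant of the subdivision. It records the edges because angles are defined through them.
\<close>

fun fat_triangle :: "real \<Rightarrow> tri \<Rightarrow> bool" where
  "fat_triangle c\<^sub>0 (Tri A B C a b c) \<longleftrightarrow>
     geodesic_segment \<kappa> B C a \<and> geodesic_segment \<kappa> C A b \<and> geodesic_segment \<kappa> A B c \<and>
     inside A \<and> inside B \<and> inside C \<and> fat c\<^sub>0 penalty (chart \<kappa> u A) (chart \<kappa> u B) (chart \<kappa> u C)"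

text \<open>
  The work is in matching orientations: each midpoint is a weighted mean seen from either end of its edge, with ratio
  \<open>\<tau>\<close> or \<open>1 - \<tau>\<close>, and fatness is invariant under rotating the three vertices, which brings any corner to the
  front.
\<close>

lemma fat_triangle_medial:
  assumes T: "fat_triangle c\<^sub>0 T" and "0 \<le> c\<^sub>0" and t: "t \<in> medial_subtriangles \<kappa> T"
  shows "fat_triangle c\<^sub>0 t"
proof -
  obtain A B C a b c where T_eq: "T = Tri A B C a b c" by (cases T)
  have seg: "geodesic_segment \<kappa> B C a" "geodesic_segment \<kappa> C A b" "geodesic_segment \<kappa> A B c"
    and in_ABC: "inside A" "inside B" "inside C"
    and fat: "fat c\<^sub>0 penalty (chart \<kappa> u A) (chart \<kappa> u B) (chart \<kappa> u C)"
    using T by (auto simp: T_eq)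
  define A' B' C' where "A' = segment_midpoint \<kappa> B C a" and "B' = segment_midpoint \<kappa> C A b"
    and "C' = segment_midpoint \<kappa> A B c"
  let ?A = "chart \<kappa> u A" and ?B = "chart \<kappa> u B" and ?C = "chart \<kappa> u C"
  have "det3 x x y = 0" "det3 y x x = 0" "det3 x y x = 0" for x y
    by (simp_all add: det3_expand algebra_simps)
  then have ne: "B \<noteq> C" "C \<noteq> A" "A \<noteq> B" using fat by (auto simp: fat_def)
  obtain p where p: "inside A'" "chart \<kappa> u A' = (1 - p) *\<^sub>R ?B + p *\<^sub>R ?C"
    "\<bar>p - 1/2\<bar> \<le> min (skew * dist ?B ?C) (1/2 - margin)"
    using inside_midpoint[OF seg(1) in_ABC(2,3) ne(1)] unfolding A'_def by blast
  obtain q where q: "inside B'" "chart \<kappa> u B' = (1 - q) *\<^sub>R ?C + q *\<^sub>R ?A"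
    "\<bar>q - 1/2\<bar> \<le> min (skew * dist ?C ?A) (1/2 - margin)"
    using inside_midpoint[OF seg(2) in_ABC(3,1) ne(2)] unfolding B'_def by blast
  obtain r where r: "inside C'" "chart \<kappa> u C' = (1 - r) *\<^sub>R ?A + r *\<^sub>R ?B"
    "\<bar>r - 1/2\<bar> \<le> min (skew * dist ?A ?B) (1/2 - margin)"
    using inside_midpoint[OF seg(3) in_ABC(1,2) ne(3)] unfolding C'_def by blast
  define D where "D = longest_side ?A ?B ?C"
  define e where "e = min (skew * D) (1/2 - margin)"
  have "skew * dist ?B ?C \<le> skew * D" "skew * dist ?C ?A \<le> skew * D" "skew * dist ?A ?B \<le> skew * D"
    using side_le_longest_side[of ?B ?C ?A] side_le_longest_side[of ?C ?A ?B]
      side_le_longest_side[of ?A ?B ?C] skew_nonneg by (auto simp: D_def intro!: mult_left_mono)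
  then have pqr: "\<bar>p - 1/2\<bar> \<le> e" "\<bar>q - 1/2\<bar> \<le> e" "\<bar>r - 1/2\<bar> \<le> e"
    using p(3) q(3) r(3) by (auto simp: e_def)
  then have pqr': "\<bar>(1 - p) - 1/2\<bar> \<le> e" "\<bar>(1 - q) - 1/2\<bar> \<le> e" "\<bar>(1 - r) - 1/2\<bar> \<le> e"
    by (auto simp: abs_le_iff)
  have e: "0 \<le> e" "e \<le> skew * D" "e \<le> 1/2 - margin" using pqr(1) by (auto simp: e_def)
  have A': "chart \<kappa> u A' = (1 - (1 - p)) *\<^sub>R ?C + (1 - p) *\<^sub>R ?B"
    and B': "chart \<kappa> u B' = (1 - (1 - q)) *\<^sub>R ?A + (1 - q) *\<^sub>R ?C"
    and C': "chart \<kappa> u C' = (1 - (1 - r)) *\<^sub>R ?B + (1 - r) *\<^sub>R ?A"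
    using p q r by (simp_all add: add.commute)
  note hk = \<open>0 \<le> c\<^sub>0\<close> margin_pos skew_nonneg penalty_def e(1)
  have f1: "fat c\<^sub>0 penalty ?A (chart \<kappa> u C') (chart \<kappa> u B')"
    unfolding r(2) B' using e pqr pqr' by (intro fat_corner[OF fat hk]) (auto simp: D_def)
  have f2: "fat c\<^sub>0 penalty ?B (chart \<kappa> u A') (chart \<kappa> u C')"
    unfolding p(2) C' using e pqr pqr' fat_rotate[of c\<^sub>0 penalty ?B ?C ?A] fat
      longest_side_rotate[of ?B ?C ?A]
    by (intro fat_corner[OF _ hk]) (auto simp: D_def)
  have f3: "fat c\<^sub>0 penalty ?C (chart \<kappa> u B') (chart \<kappa> u A')"
    unfolding q(2) A' using e pqr pqr' fat_rotate[of c\<^sub>0 penalty ?A ?B ?C] fat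
      longest_side_rotate[of ?A ?B ?C]
    by (intro fat_corner[OF _ hk]) (auto simp: D_def)
  have f4: "fat c\<^sub>0 penalty (chart \<kappa> u A') (chart \<kappa> u B') (chart \<kappa> u C')"
    unfolding p(2) q(2) r(2) using e pqr by (intro fat_inner_triangle[OF fat hk]) (auto simp: D_def)
  note fats = f1 fat_rotate[THEN iffD1, OF f2] fat_rotate[THEN iffD2, OF f3] f4
  note sub = geodesic_segment_half[OF seg(1), folded A'_def] geodesic_segment_half[OF seg(2), folded B'_def]
    geodesic_segment_half[OF seg(3), folded C'_def]
    geodesic_segment_half[OF geodesic_segment_commute[OF seg(1)],
      unfolded segment_midpoint_commute[of \<kappa> C B], folded A'_def]
    geodesic_segment_half[OF geodesic_segment_commute[OF seg(2)],
      unfolded segment_midpoint_commute[of \<kappa> A C], folded B'_def]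
    geodesic_segment_half[OF geodesic_segment_commute[OF seg(3)],
      unfolded segment_midpoint_commute[of \<kappa> B A], folded C'_def]
  obtain a' b' c' where new: "geodesic_segment \<kappa> B' C' a'" "geodesic_segment \<kappa> C' A' b'"
      "geodesic_segment \<kappa> A' B' c'"
    and t_cases: "t \<in> {Tri A C' B' a' (subsegment \<kappa> A B' b) (subsegment \<kappa> A C' c),
                    Tri C' B A' (subsegment \<kappa> B A' a) b' (subsegment \<kappa> B C' c),
                    Tri B' A' C (subsegment \<kappa> C A' a) (subsegment \<kappa> C B' b) c',
                    Tri A' B' C' a' b' c'}"
    using t unfolding T_eq medial_subtriangles.simps Let_def A'_def B'_def C'_def by blast
  from t_cases show ?thesis
    using fats sub sub[THEN geodesic_segment_commute] new new[THEN geodesic_segment_commute]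
      in_ABC p(1) q(1) r(1)
    by (elim insertE emptyE) (simp_all only: fat_triangle.simps simp_thms)
qed

lemma vertex_angle_bounds:
  assumes S: "geodesic_segment \<kappa> p q S" and S': "geodesic_segment \<kappa> p r' S'"
    and ins: "inside p" "inside q" "inside r'" and "0 < c\<^sub>0"
    and ne: "det3 (chart \<kappa> u p) (chart \<kappa> u q) (chart \<kappa> u r') \<noteq> 0"
    and D: "dist (chart \<kappa> u p) (chart \<kappa> u q) \<le> D" "dist (chart \<kappa> u p) (chart \<kappa> u r') \<le> D"
    and det: "c\<^sub>0 * D\<^sup>2 \<le> \<bar>det3 (chart \<kappa> u p) (chart \<kappa> u q) (chart \<kappa> u r')\<bar>"
  defines "\<sigma> \<equiv> min 1 ((if \<kappa> = 0 then 1 else \<bar>\<kappa>\<bar>) * (w\<^sub>0 ^ 3 * c\<^sub>0 / sn_factor\<^sup>2)\<^sup>2)"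
  shows "arccos (sqrt (1 - \<sigma>)) \<le> geodesic_angle \<kappa> p S S'"
    "geodesic_angle \<kappa> p S S' \<le> pi - arccos (sqrt (1 - \<sigma>))"
proof -
  let ?p = "chart \<kappa> u p" and ?q = "chart \<kappa> u q" and ?r = "chart \<kappa> u r'"
  have on: "p \<in> model_surface \<kappa>" "q \<in> model_surface \<kappa>" "r' \<in> model_surface \<kappa>"
    and pos: "0 < weight \<kappa> u p" "0 < weight \<kappa> u q" "0 < weight \<kappa> u r'"
    and inK: "?p \<in> K" "?q \<in> K" "?r \<in> K"
    using ins by (auto simp: inside_def)
  have "p \<noteq> q" "p \<noteq> r'" using ne by (auto simp: det3_expand algebra_simps)
  note L = model_dist_pos_chart[OF on(1,2) pos(1,2) this(1)]
    and L' = model_dist_pos_chart[OF on(1,3) pos(1,3) this(2)]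
  let ?s = "sn \<kappa> (model_dist \<kappa> p q)" and ?s' = "sn \<kappa> (model_dist \<kappa> p r')"
  note wb = weight_bounds[OF on(1) pos(1) inK(1)] weight_bounds[OF on(2) pos(2) inK(2)]
    weight_bounds[OF on(3) pos(3) inK(3)]
  have D0: "0 \<le> D" using D(1) zero_le_dist order_trans by blast
  have "?s \<le> sn_factor * dist ?p ?q"
    unfolding sn_factor_def using wb norm_chart inK pos adapted by (intro sn_dist_le_chart_dist[OF on(1,2)]) auto
  also have "\<dots> \<le> sn_factor * D" using D sn_factor_pos by simp
  finally have s: "?s \<le> sn_factor * D" .
  have "?s' \<le> sn_factor * dist ?p ?r"
    unfolding sn_factor_def using wb norm_chart inK pos adapted by (intro sn_dist_le_chart_dist[OF on(1,3)]) auto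
  also have "\<dots> \<le> sn_factor * D" using D sn_factor_pos by simp
  finally have s': "?s' \<le> sn_factor * D" .
  have ss: "0 < ?s * ?s'" "?s * ?s' \<le> sn_factor\<^sup>2 * D\<^sup>2"
    using mult_mono[OF s s'] L L' sn_factor_pos D0 by (auto simp: power2_eq_square mult_ac)
  let ?d = "det3 (cone_point \<kappa> p) (cone_point \<kappa> q) (cone_point \<kappa> r')"
  have "\<bar>?d\<bar> = weight \<kappa> u p * weight \<kappa> u q * weight \<kappa> u r' * \<bar>det3 ?p ?q ?r\<bar>"
    using pos by (simp add: cone_point_eq_chart[OF pos(1)] cone_point_eq_chart[OF pos(2)]
        cone_point_eq_chart[OF pos(3)] det3_scaleR abs_mult)
  moreover have "w\<^sub>0 * w\<^sub>0 * w\<^sub>0 * (c\<^sub>0 * D\<^sup>2)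
      \<le> weight \<kappa> u p * weight \<kappa> u q * weight \<kappa> u r' * \<bar>det3 ?p ?q ?r\<bar>"
    using wb det w\<^sub>0 \<open>0 < c\<^sub>0\<close> pos by (intro mult_mono) auto
  ultimately have d: "w\<^sub>0 ^ 3 * c\<^sub>0 * D\<^sup>2 \<le> \<bar>?d\<bar>" by (simp add: power3_eq_cube mult_ac)
  have "w\<^sub>0 ^ 3 * c\<^sub>0 / sn_factor\<^sup>2 * (?s * ?s') \<le> w\<^sub>0 ^ 3 * c\<^sub>0 / sn_factor\<^sup>2 * (sn_factor\<^sup>2 * D\<^sup>2)"
    using ss w\<^sub>0 \<open>0 < c\<^sub>0\<close> by (intro mult_left_mono) auto
  also have "\<dots> = w\<^sub>0 ^ 3 * c\<^sub>0 * D\<^sup>2" using sn_factor_pos by simp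
  also note d
  finally have "w\<^sub>0 ^ 3 * c\<^sub>0 / sn_factor\<^sup>2 \<le> \<bar>?d\<bar> / (?s * ?s')" using ss(1) by (subst pos_le_divide_eq)
  then have "(w\<^sub>0 ^ 3 * c\<^sub>0 / sn_factor\<^sup>2)\<^sup>2 \<le> (\<bar>?d\<bar> / (?s * ?s'))\<^sup>2"
    using w\<^sub>0 \<open>0 < c\<^sub>0\<close> by (intro power_mono) auto
  also have "\<dots> = (?d / (?s * ?s'))\<^sup>2" by (simp add: power_divide)
  finally have "(if \<kappa> = 0 then 1 else \<bar>\<kappa>\<bar>) * (w\<^sub>0 ^ 3 * c\<^sub>0 / sn_factor\<^sup>2)\<^sup>2
      \<le> (if \<kappa> = 0 then 1 else \<bar>\<kappa>\<bar>) * (?d / (?s * ?s'))\<^sup>2" by (intro mult_left_mono) auto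
  then have \<sigma>: "\<sigma> \<le> (if \<kappa> = 0 then 1 else \<bar>\<kappa>\<bar>) * (?d / (?s * ?s'))\<^sup>2"
    unfolding \<sigma>_def by (rule min.coboundedI2)
  have "0 < \<sigma>" "\<sigma> \<le> 1" using w\<^sub>0 \<open>0 < c\<^sub>0\<close> sn_factor_pos by (auto simp: \<sigma>_def)
  then show "arccos (sqrt (1 - \<sigma>)) \<le> geodesic_angle \<kappa> p S S'"
    "geodesic_angle \<kappa> p S S' \<le> pi - arccos (sqrt (1 - \<sigma>))"
    using geodesic_angle_bounds[OF S S' refl L refl L' _ _ \<sigma>] by auto
qed

lemma fat_triangle_angles:
  assumes "0 < c\<^sub>0"
  shows "\<exists>\<delta>>0. \<forall>t. fat_triangle c\<^sub>0 t \<longrightarrow> angles \<kappa> t \<subseteq> {\<delta><..<pi - \<delta>}"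
proof -
  define \<sigma> where "\<sigma> = min 1 ((if \<kappa> = 0 then 1 else \<bar>\<kappa>\<bar>) * (w\<^sub>0 ^ 3 * c\<^sub>0 / sn_factor\<^sup>2)\<^sup>2)"
  define \<alpha> where "\<alpha> = arccos (sqrt (1 - \<sigma>))"
  have \<sigma>: "0 < \<sigma>" "\<sigma> \<le> 1" using w\<^sub>0 \<open>0 < c\<^sub>0\<close> sn_factor_pos by (auto simp: \<sigma>_def)
  have "0 \<le> sqrt (1 - \<sigma>)" "sqrt (1 - \<sigma>) < 1" using \<sigma> by auto
  then have "- 1 \<le> sqrt (1 - \<sigma>)" "sqrt (1 - \<sigma>) < 1" by linarith+
  then have \<alpha>: "0 < \<alpha>" using arccos_less_arccos[of "sqrt (1 - \<sigma>)" 1] by (simp add: \<alpha>_def)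
  have "angles \<kappa> t \<subseteq> {\<alpha> / 2<..<pi - \<alpha> / 2}" if "fat_triangle c\<^sub>0 t" for t
  proof -
    obtain A B E a b c where t: "t = Tri A B E a b c" by (cases t)
    let ?A = "chart \<kappa> u A" and ?B = "chart \<kappa> u B" and ?E = "chart \<kappa> u E"
    define D where "D = longest_side ?A ?B ?E"
    have seg: "geodesic_segment \<kappa> B E a" "geodesic_segment \<kappa> E A b" "geodesic_segment \<kappa> A B c"
      and ins: "inside A" "inside B" "inside E" and fat: "fat c\<^sub>0 penalty ?A ?B ?E"
      using that by (auto simp: t)
    note seg' = seg[THEN geodesic_segment_commute]
    have side: "dist ?A ?B \<le> D" "dist ?B ?A \<le> D" "dist ?A ?E \<le> D" "dist ?E ?A \<le> D"
      "dist ?B ?E \<le> D" "dist ?E ?B \<le> D"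
      using side_le_longest_side[of ?B ?E ?A] side_le_longest_side[of ?E ?A ?B]
        side_le_longest_side[of ?A ?B ?E] by (simp_all add: D_def dist_commute)
    have "0 \<le> penalty * D" using skew_nonneg longest_side_nonneg by (auto simp: penalty_def D_def)
    then have "c\<^sub>0 * D\<^sup>2 * 1 \<le> c\<^sub>0 * D\<^sup>2 * exp (penalty * D)"
      using \<open>0 < c\<^sub>0\<close> by (intro mult_left_mono) auto
    then have det: "c\<^sub>0 * D\<^sup>2 \<le> \<bar>det3 ?A ?B ?E\<bar>" "det3 ?A ?B ?E \<noteq> 0"
      using fat by (auto simp: fat_def D_def)
    have perm: "det3 ?A ?E ?B = - det3 ?A ?B ?E" "det3 ?B ?A ?E = - det3 ?A ?B ?E"
      "det3 ?E ?B ?A = - det3 ?A ?B ?E"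
      by (simp_all add: det3_expand algebra_simps)
    note bounds = vertex_angle_bounds[OF _ _ _ _ _ \<open>0 < c\<^sub>0\<close>, folded \<sigma>_def, folded \<alpha>_def]
    have "\<alpha> \<le> geodesic_angle \<kappa> A b c \<and> geodesic_angle \<kappa> A b c \<le> pi - \<alpha>"
      using bounds[OF seg'(2) seg(3) ins(1,3,2), of D] side det perm by simp
    moreover have "\<alpha> \<le> geodesic_angle \<kappa> B c a \<and> geodesic_angle \<kappa> B c a \<le> pi - \<alpha>"
      using bounds[OF seg'(3) seg(1) ins(2,1,3), of D] side det perm by simp
    moreover have "\<alpha> \<le> geodesic_angle \<kappa> E a b \<and> geodesic_angle \<kappa> E a b \<le> pi - \<alpha>"
      using bounds[OF seg'(1) seg(2) ins(3,2,1), of D] side det perm by simp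
    ultimately show ?thesis using \<alpha> by (auto simp: t)
  qed
  then show ?thesis using \<alpha> by (intro exI[of _ "\<alpha> / 2"]) auto
qed

lemma fat_triangle_iterated_medial:
  assumes "fat_triangle c\<^sub>0 T" "0 \<le> c\<^sub>0" "t \<in> iterated_medial \<kappa> T n"
  shows "fat_triangle c\<^sub>0 t"
  using assms(3)
proof (induction n arbitrary: t)
  case 0
  then show ?case using assms(1) by simp
next
  case (Suc n)
  then show ?case using fat_triangle_medial[OF _ \<open>0 \<le> c\<^sub>0\<close>] by auto
qed

end

text \<open>
  For \<open>\<kappa> \<noteq> 0\<close> the weight is \<open>1 / sqrt (g x)\<close> at the chart point \<open>x\<close>, where \<open>g x = \<kappa> \<langle>x|x\<rangle>\<close>. On the compact
  set \<open>K\<close> the positive function \<open>g\<close> has a positive minimum, and being quadratic it is bounded and Lipschitz there.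
\<close>

lemma ex_bounded_chart:
  assumes u: "adapted \<kappa> u" and K: "convex K" "compact K" "K \<noteq> {}"
    and pos: "\<And>x. x \<in> K \<Longrightarrow> \<kappa> \<noteq> 0 \<Longrightarrow> 0 < \<kappa> * model_form \<kappa> x x"
  shows "\<exists>w\<^sub>0 W \<Lambda> r. bounded_chart \<kappa> u K w\<^sub>0 W \<Lambda> r"
proof -
  obtain r where r: "0 < r" "\<And>x. x \<in> K \<Longrightarrow> norm x \<le> r"
    using compact_imp_bounded[OF K(2)] by (auto simp: bounded_pos)
  show ?thesis
  proof (cases "\<kappa> = 0")
    case True
    then have "weight \<kappa> u X = 1" if "X \<in> model_surface \<kappa>" for X using weight_flat u that by simp
    then have "bounded_chart \<kappa> u K 1 1 0 r" using u K r by unfold_locales auto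
    then show ?thesis by blast
  next
    case False
    define g where "g x = \<kappa> * model_form \<kappa> x x" for x
    have "continuous_on K g" unfolding g_def model_form_coords by (intro continuous_intros)
    then obtain x\<^sub>0 where x0: "x\<^sub>0 \<in> K" "\<And>x. x \<in> K \<Longrightarrow> g x\<^sub>0 \<le> g x"
      using continuous_attains_inf[OF K(2,3)] by blast
    define m where "m = g x\<^sub>0"
    have m: "0 < m" "\<And>x. x \<in> K \<Longrightarrow> m \<le> g x" using x0 pos False by (auto simp: m_def g_def)
    have g_le: "g x \<le> \<bar>\<kappa>\<bar> * r\<^sup>2" if "x \<in> K" for x
    proof -
      have "g x \<le> \<bar>\<kappa>\<bar> * \<bar>model_form \<kappa> x x\<bar>" by (simp add: g_def flip: abs_mult)
      also have "\<dots> \<le> \<bar>\<kappa>\<bar> * (norm x * norm x)" using abs_model_form_le by (intro mult_left_mono) auto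
      also have "\<dots> \<le> \<bar>\<kappa>\<bar> * (r * r)" using r that by (intro mult_left_mono mult_mono) (auto intro: less_imp_le)
      finally show ?thesis by (simp add: power2_eq_square)
    qed
    have g_diff: "\<bar>g x - g y\<bar> \<le> \<bar>\<kappa>\<bar> * (2 * r) * dist x y" if "x \<in> K" "y \<in> K" for x y
    proof -
      have "g x - g y = \<kappa> * model_form \<kappa> (x - y) (x + y)"
        by (simp add: g_def model_form_linear model_form_commute[of \<kappa> y x] algebra_simps)
      then have "\<bar>g x - g y\<bar> = \<bar>\<kappa>\<bar> * \<bar>model_form \<kappa> (x - y) (x + y)\<bar>" by (simp add: abs_mult)
      also have "\<dots> \<le> \<bar>\<kappa>\<bar> * (norm (x - y) * norm (x + y))"
        using abs_model_form_le by (intro mult_left_mono) auto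
      also have "\<dots> \<le> \<bar>\<kappa>\<bar> * (norm (x - y) * (2 * r))"
        using norm_triangle_ineq[of x y] r(2)[OF that(1)] r(2)[OF that(2)]
        by (intro mult_left_mono) auto
      finally show ?thesis by (simp add: dist_norm mult_ac)
    qed
    define w\<^sub>0 W where "w\<^sub>0 = 1 / (sqrt \<bar>\<kappa>\<bar> * r)" and "W = 1 / sqrt m"
    have w0: "0 < w\<^sub>0" using False r by (simp add: w\<^sub>0_def)
    have W0: "0 < W" using m by (simp add: W_def)
    have W2: "W\<^sup>2 = 1 / m" and w2: "w\<^sub>0\<^sup>2 = 1 / (\<bar>\<kappa>\<bar> * r\<^sup>2)"
      using m by (simp_all add: W_def w\<^sub>0_def power_divide power_mult_distrib)
    have w: "w\<^sub>0 \<le> weight \<kappa> u X" "weight \<kappa> u X \<le> W" "(weight \<kappa> u X)\<^sup>2 * g (chart \<kappa> u X) = 1"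
      if X: "X \<in> model_surface \<kappa>" "0 < weight \<kappa> u X" "chart \<kappa> u X \<in> K" for X
    proof -
      have g: "0 < g (chart \<kappa> u X)" using m X(3) by fastforce
      show eq: "(weight \<kappa> u X)\<^sup>2 * g (chart \<kappa> u X) = 1"
        using weight_form_chart[OF X(1) False X(2)] by (simp add: g_def)
      then have sq: "(weight \<kappa> u X)\<^sup>2 = 1 / g (chart \<kappa> u X)" using g by (simp add: field_simps)
      have "1 / g (chart \<kappa> u X) \<le> 1 / m" using m X(3) g by (intro divide_left_mono) auto
      then have "(weight \<kappa> u X)\<^sup>2 \<le> W\<^sup>2" by (simp only: sq W2)
      then show "weight \<kappa> u X \<le> W" by (rule power2_le_imp_le) (use W0 in simp)
      have "1 / (\<bar>\<kappa>\<bar> * r\<^sup>2) \<le> 1 / g (chart \<kappa> u X)"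
        using g_le[OF X(3)] g by (intro divide_left_mono) auto
      then have "w\<^sub>0\<^sup>2 \<le> (weight \<kappa> u X)\<^sup>2" by (simp only: sq w2)
      then show "w\<^sub>0 \<le> weight \<kappa> u X" by (rule power2_le_imp_le) (use X in simp)
    qed
    define \<Lambda> where "\<Lambda> = W ^ 4 * (\<bar>\<kappa>\<bar> * (2 * r)) / (2 * w\<^sub>0)"
    have "bounded_chart \<kappa> u K w\<^sub>0 W \<Lambda> r"
    proof unfold_locales
      have "1 / (\<bar>\<kappa>\<bar> * r\<^sup>2) \<le> 1 / m"
        using m g_le[OF x0(1)] by (intro divide_left_mono) (auto simp: m_def)
      then have "w\<^sub>0\<^sup>2 \<le> W\<^sup>2" by (simp only: W2 w2)
      then show "w\<^sub>0 \<le> W" by (rule power2_le_imp_le) (use W0 in simp)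
      show "0 \<le> \<Lambda>" using W0 w0 r by (simp add: \<Lambda>_def)
    next
      fix X Y
      assume X: "X \<in> model_surface \<kappa>" "0 < weight \<kappa> u X" "chart \<kappa> u X \<in> K"
        and Y: "Y \<in> model_surface \<kappa>" "0 < weight \<kappa> u Y" "chart \<kappa> u Y \<in> K"
      define x y where "x = weight \<kappa> u X" and "y = weight \<kappa> u Y"
      let ?gx = "g (chart \<kappa> u X)" and ?gy = "g (chart \<kappa> u Y)" and ?d = "dist (chart \<kappa> u X) (chart \<kappa> u Y)"
      note wX = w[OF X, folded x_def] and wY = w[OF Y, folded y_def]
      have xy: "0 < x" "0 < y" using X Y by (simp_all add: x_def y_def)
      \<comment> \<open>Both sides equal \<open>x\<^sup>2 - y\<^sup>2\<close>, as \<open>x\<^sup>2 ?gx = y\<^sup>2 ?gy = 1\<close>.\<close>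
      have "(x - y) * (x + y) = x\<^sup>2 * y\<^sup>2 * (?gy - ?gx)"
        using wX(3) wY(3) by algebra
      then have "\<bar>x - y\<bar> * (x + y) = x\<^sup>2 * y\<^sup>2 * \<bar>?gy - ?gx\<bar>"
        using xy by (metis abs_mult abs_of_pos add_pos_pos abs_power2)
      also have "\<dots> \<le> W\<^sup>2 * W\<^sup>2 * (\<bar>\<kappa>\<bar> * (2 * r) * ?d)"
        using g_diff[OF X(3) Y(3)] wX(2) wY(2) xy
        by (intro mult_mono power_mono) (auto simp: abs_minus_commute)
      finally have "\<bar>x - y\<bar> * (x + y) \<le> W ^ 4 * (\<bar>\<kappa>\<bar> * (2 * r)) * ?d"
        by (simp add: power2_eq_square eval_nat_numeral mult_ac)
      moreover have "\<bar>x - y\<bar> * (2 * w\<^sub>0) \<le> \<bar>x - y\<bar> * (x + y)"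
        using wX(1) wY(1) by (intro mult_left_mono) auto
      ultimately have "\<bar>x - y\<bar> * (2 * w\<^sub>0) \<le> W ^ 4 * (\<bar>\<kappa>\<bar> * (2 * r)) * ?d" by linarith
      then have "\<bar>x - y\<bar> \<le> W ^ 4 * (\<bar>\<kappa>\<bar> * (2 * r)) * ?d / (2 * w\<^sub>0)"
        using w0 by (subst pos_le_divide_eq) auto
      then show "\<bar>weight \<kappa> u X - weight \<kappa> u Y\<bar> \<le> \<Lambda> * ?d" by (simp add: x_def y_def \<Lambda>_def)
    qed (use u K r w w0 in auto)
    then show ?thesis by blast
  qed
qed

text \<open>
  The open cone over the surface is convex. On the sphere the hull lies in a plane that misses the origin; in the
  hyperbolic case it lies in the open unit disc at height 1, the Klein model, where the form is
  negative.
\<close>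

lemma form_pos_on_chart_hull:
  assumes u: "adapted \<kappa> u" and "\<kappa> \<noteq> 0"
    and F: "\<And>X. X \<in> F \<Longrightarrow> X \<in> model_surface \<kappa> \<and> 0 < weight \<kappa> u X"
    and x: "x \<in> convex hull (chart \<kappa> u ` F)"
  shows "0 < \<kappa> * model_form \<kappa> x x"
proof -
  have plane: "chart \<kappa> u ` F \<subseteq> {x. u \<bullet> x = 1}" using inner_chart F by blast
  show ?thesis
  proof (cases "\<kappa> > 0")
    case True
    have "convex hull (chart \<kappa> u ` F) \<subseteq> {x. u \<bullet> x = 1}"
      using plane convex_hyperplane by (intro hull_minimal) auto
    then have "x \<noteq> 0" using x by auto
    then show ?thesis using True by (simp add: model_form_def)
  next
    case False
    with \<open>\<kappa> \<noteq> 0\<close> have k: "\<kappa> < 0" by simp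
    then have u3: "u = axis 3 1" using u by (simp add: adapted_def)
    have in_disc: "y \<in> ball (axis 3 1) 1 \<longleftrightarrow> model_form \<kappa> y y < 0" if "u \<bullet> y = 1" for y
    proof -
      have y3: "y$3 = 1" using that by (simp add: u3 inner_axis')
      have "y \<in> ball (axis 3 1) 1 \<longleftrightarrow> norm (axis 3 1 - y) < 1" by (simp add: dist_norm)
      also have "\<dots> \<longleftrightarrow> (y$1)\<^sup>2 + (y$2)\<^sup>2 < 1"
        unfolding norm_eq_sqrt_inner using y3
        by (simp add: inner_real3 axis_def power2_eq_square)
      finally show ?thesis using k y3 by (simp add: model_form_coords power2_eq_square)
    qed
    have "chart \<kappa> u X \<in> ball (axis 3 1) 1" if "X \<in> F" for X
    proof -
      have X: "X \<in> model_surface \<kappa>" "0 < weight \<kappa> u X" using F that by auto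
      have "(weight \<kappa> u X)\<^sup>2 * (\<kappa> * model_form \<kappa> (chart \<kappa> u X) (chart \<kappa> u X)) = 1"
        using weight_form_chart X \<open>\<kappa> \<noteq> 0\<close> by blast
      then have "0 < \<kappa> * model_form \<kappa> (chart \<kappa> u X) (chart \<kappa> u X)"
        by (metis zero_less_mult_pos zero_less_one X(2) zero_less_power)
      then show ?thesis using in_disc[OF inner_chart[OF X(2)]] k by (simp add: zero_less_mult_iff)
    qed
    then have "convex hull (chart \<kappa> u ` F) \<subseteq> {x. u \<bullet> x = 1} \<inter> ball (axis 3 1) 1"
      using plane by (intro hull_minimal convex_Int convex_hyperplane convex_ball) auto
    then have "model_form \<kappa> x x < 0" using x in_disc by blast
    then show ?thesis using k by (simp add: mult_neg_neg)
  qed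
qed

theorem theoremA:
  fixes \<kappa> :: real and T :: tri
  assumes "geodesic_triangle \<kappa> T"
    and "nondegenerate \<kappa> T"
  shows "\<exists>\<delta>>0. \<forall>n. \<forall>t\<in>iterated_medial \<kappa> T n. angles \<kappa> t \<subseteq> {\<delta><..<pi - \<delta>}"
proof -
  obtain A B C a b c where T: "T = Tri A B C a b c" by (cases T)
  have seg: "geodesic_segment \<kappa> B C a" "geodesic_segment \<kappa> C A b" "geodesic_segment \<kappa> A B c"
    using assms(1) by (auto simp: T)
  then have on: "A \<in> model_surface \<kappa>" "B \<in> model_surface \<kappa>" "C \<in> model_surface \<kappa>"
    by (auto simp: geodesic_segment_def)
  have "\<exists>u. adapted \<kappa> u \<and> 0 < weight \<kappa> u A \<and> 0 < weight \<kappa> u B \<and> 0 < weight \<kappa> u C"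
  proof (cases "\<kappa> > 0")
    case True
    then show ?thesis using assms(1) by (auto simp: T adapted_def weight_def cone_point_def)
  next
    case False
    then have "adapted \<kappa> (axis 3 1)" by (simp add: adapted_def)
    then show ?thesis using weight_pos_nonpos on False by (meson not_less)
  qed
  then obtain u where u: "adapted \<kappa> u"
    and w: "0 < weight \<kappa> u A" "0 < weight \<kappa> u B" "0 < weight \<kappa> u C" by blast
  define K where "K = convex hull (chart \<kappa> u ` {A, B, C})"
  have "chart \<kappa> u ` {A, B, C} \<subseteq> K" unfolding K_def by (rule hull_subset)
  have "0 < \<kappa> * model_form \<kappa> x x" if "x \<in> K" "\<kappa> \<noteq> 0" for x
    using form_pos_on_chart_hull[OF u that(2), of "{A, B, C}" x] on w that(1) by (auto simp: K_def)
  then obtain w\<^sub>0 W \<Lambda> r where "bounded_chart \<kappa> u K w\<^sub>0 W \<Lambda> r"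
    using ex_bounded_chart[OF u, of K]
    by (auto simp: K_def finite_imp_compact_convex_hull)
  then interpret bounded_chart \<kappa> u K w\<^sub>0 W \<Lambda> r .
  let ?A = "chart \<kappa> u A" and ?B = "chart \<kappa> u B" and ?C = "chart \<kappa> u C"
  define D where "D = longest_side ?A ?B ?C"
  define c\<^sub>0 where "c\<^sub>0 = \<bar>det3 ?A ?B ?C\<bar> / (D\<^sup>2 * exp (penalty * D))"
  have det: "det3 ?A ?B ?C \<noteq> 0" using chart_det3_nonzero[of \<kappa> A B C a b c u] assms w u by (simp add: T)
  then have "?A \<noteq> ?B" by (auto simp: det3_expand algebra_simps)
  then have D: "0 < D" using side_le_longest_side(3)[where a = ?A and b = ?B and c = ?C] unfolding D_def
    by (metis dist_pos_lt less_le_trans)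
  then have c0: "0 < c\<^sub>0" using det by (simp add: c\<^sub>0_def)
  have "fat c\<^sub>0 penalty ?A ?B ?C" using det D by (simp add: fat_def c\<^sub>0_def D_def[symmetric])
  moreover have "inside A" "inside B" "inside C"
    unfolding inside_def using on w \<open>chart \<kappa> u ` {A, B, C} \<subseteq> K\<close> by auto
  ultimately have "fat_triangle c\<^sub>0 T" using seg by (simp add: T)
  then show ?thesis
    using fat_triangle_angles[OF c0] fat_triangle_iterated_medial c0 by (meson less_imp_le)
qed

end
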